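(* Let $\hat{\mathfrak h}$ be the Lie algebra with basis $\{h(n)\mid n\in\mathbb Z\}\cup\{1\}$, where $1$ and $h(0)$ are central and $[h(m),h(n)]=m\,\delta_{m+n,0}\,1$ for all $m,n\in\mathbb Z$. Let it act on $S=\mathbb C[h(-1),h(-2),h(-3),\dots]$ as follows: for $n<0$, $h(n)$ acts by multiplication; for $n>0$, $h(n)$ acts as $n\,\partial/\partial h(-n)$; $h(0)$ acts as $0$; and $1$ acts as the identity. Put $h(x)=\sum_{n\in\mathbb Z}h(n)x^{-n}$. For independent commuting formal variables $y_1,y_2,x$ define $$\bar L^{(y_1,y_2)}(x)=\tfrac12\Big({:}h(e^{y_1}x)h(e^{y_2}x){:}-\frac{\partial}{\partial y_1}\frac{1}{1-e^{-y_1+y_2}}\Big),$$ where ${:}h(e^{y_1}x)h(e^{y_2}x){:}=\sum_{m,n\in\mathbb Z}{:}h(m)h(n){:}\,e^{-my_1-ny_2}x^{-m-n}$ (the exponentials expanded as formal power series), ${:}\cdot{:}$ denotes normal ordering (each $h(k)$ with $k>0$ placed to the right of each $h(k)$ with $k<0$), and $\frac{1}{1-e^{-y_1+y_2}}$ denotes the formal Laurent series $(y_1-y_2)^{-1}F(y_1,y_2)$, where $F(y_1,y_2)$ is the formal power series $\frac{y_1-y_2}{1-e^{-(y_1-y_2)}}$ and $(y_1-y_2)^{-1}=\sum_{k\ge0}y_2^k y_1^{-k-1}$. Let $\delta(x)=\sum_{n\in\mathbb Z}x^n$. Then, as operators on $S$, with independent commuting formal variables $x_1,x_2,y_1,y_2,y_3,y_4$,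 \begin{align*} [\bar L^{(y_1,y_2)}(x_1),\bar L^{(y_3,y_4)}(x_2)] &=-\tfrac12\frac{\partial}{\partial y_1}\Big(\bar L^{(-y_1+y_2+y_3,\,y_4)}(x_2)\,\delta\!\Big(\frac{e^{y_1}x_1}{e^{y_3}x_2}\Big)+\bar L^{(-y_1+y_2+y_4,\,y_3)}(x_2)\,\delta\!\Big(\frac{e^{y_1}x_1}{e^{y_4}x_2}\Big)\Big)\\ &\quad-\tfrac12\frac{\partial}{\partial y_2}\Big(\bar L^{(y_1-y_2+y_3,\,y_4)}(x_2)\,\delta\!\Big(\frac{e^{y_2}x_1}{e^{y_3}x_2}\Big)+\bar L^{(y_1-y_2+y_4,\,y_3)}(x_2)\,\delta\!\Big(\frac{e^{y_2}x_1}{e^{y_4}x_2}\Big)\Big). \end{align*}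
   Context: All variables are commuting formal variables and all identities are identities of formal series with operator coefficients (each coefficient acting on any fixed vector of $S$ by a finite sum). Expressions such as $\delta\big(\frac{e^{y_1}x_1}{e^{y_3}x_2}\big)=\sum_{n\in\mathbb Z}e^{n(y_1-y_3)}x_1^nx_2^{-n}$ are expanded with the exponentials as formal power series. In $\bar L^{(a,b)}(x_2)$ with $a,b$ linear combinations of the $y_i$ as on the right-hand side, the substitution is made into the defining formula; negative powers of a sum of formal variables arising (e.g. $(a-b)^{-1}$) are, following the paper's convention for binomial expansions, expanded in nonnegative powers of all summands other than the first. *)

theory Defs
  imports Complex_Main "HOL-Library.Multiset" "HOL-Library.Function_Algebras"
    "HOL-Library.Groups_Big_Fun" "HOL-Computational_Algebra.Formal_Laurent_Series"
begin

text \<open>A monomial of S is a finite multiset of positive naturals: k occurring with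
  multiplicity c stands for the factor h(-k)^c.  A vector of S is a finitely supported
  complex-valued function on monomials, supported on multisets not containing 0.\<close>

type_synonym vec = "nat multiset \<Rightarrow> complex"
type_synonym op = "vec \<Rightarrow> vec"

definition fock_vec :: "vec \<Rightarrow> bool" where
  "fock_vec v \<longleftrightarrow> finite {m. v m \<noteq> 0} \<and> (\<forall>m. v m \<noteq> 0 \<longrightarrow> 0 \<notin># m)"

definition vscale :: "complex \<Rightarrow> vec \<Rightarrow> vec" where
  "vscale c v = (\<lambda>m. c * v m)"

text \<open>Action of h(n): multiplication by h(n) for n<0, n d/dh(-n) for n>0, 0 for n=0.\<close>
definition hop :: "int \<Rightarrow> op" where
  "hop n v =
     (if n < 0 then (\<lambda>m. if nat (-n) \<in># m then v (m - {#nat (-n)#}) else 0)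
      else if 0 < n then (\<lambda>m. of_int n * of_nat (count m (nat n) + 1) * v (add_mset (nat n) m))
      else (\<lambda>m. 0))"

definition normord :: "int \<Rightarrow> int \<Rightarrow> op" where
  "normord m n = (if 0 < m \<and> n < 0 then hop n \<circ> hop m else hop m \<circ> hop n)"

datatype var = X1 | X2 | Y1 | Y2 | Y3 | Y4

definition Ys :: "var set" where "Ys = {Y1, Y2, Y3, Y4}"

text \<open>A series assigns to every integer exponent vector (monomial) its coefficient operator.\<close>
type_synonym opser = "(var \<Rightarrow> int) \<Rightarrow> op"

definition ser_add :: "opser \<Rightarrow> opser \<Rightarrow> opser" where
  "ser_add A B = (\<lambda>e v. A e v + B e v)"

definition ser_sub :: "opser \<Rightarrow> opser \<Rightarrow> opser" where
  "ser_sub A B = (\<lambda>e v. A e v - B e v)"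

definition ser_scale :: "complex \<Rightarrow> opser \<Rightarrow> opser" where
  "ser_scale c A = (\<lambda>e v. vscale c (A e v))"

text \<open>Product: coefficient of x^e is the sum over e1+e2=e of A_e1 B_e2; on a fixed vector
  this is required to be a finite sum (Sum_any; all sums occurring below are finite).\<close>
definition ser_mult :: "opser \<Rightarrow> opser \<Rightarrow> opser" where
  "ser_mult A B = (\<lambda>e v. Sum_any (\<lambda>e1. A e1 (B (\<lambda>w. e w - e1 w) v)))"

definition ser_comm :: "opser \<Rightarrow> opser \<Rightarrow> opser" where
  "ser_comm A B = ser_sub (ser_mult A B) (ser_mult B A)"

definition ser_deriv :: "var \<Rightarrow> opser \<Rightarrow> opser" where
  "ser_deriv w A = (\<lambda>e v. vscale (of_int (e w + 1)) (A (e(w := e w + 1)) v))"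

definition scalar_ser :: "((var \<Rightarrow> int) \<Rightarrow> complex) \<Rightarrow> opser" where
  "scalar_ser f = (\<lambda>e v. vscale (f e) v)"

text \<open>Coefficient of y^e in exp(sum_w c_w y_w) = prod_w exp(c_w y_w) (formal power series).\<close>
definition expcoef :: "(var \<Rightarrow> complex) \<Rightarrow> (var \<Rightarrow> int) \<Rightarrow> complex" where
  "expcoef c e = (if \<forall>w\<in>Ys. 0 \<le> e w
      then (\<Prod>w\<in>Ys. c w ^ nat (e w) / of_nat (fact (nat (e w)))) else 0)"

text \<open>Linear forms in the y's with integer coefficients.\<close>
definition yv :: "var \<Rightarrow> var \<Rightarrow> int" where
  "yv w = (\<lambda>u. if u = w then 1 else 0)"

definition lead :: "(var \<Rightarrow> int) \<Rightarrow> var" where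
  "lead c = (if c Y1 \<noteq> 0 then Y1 else if c Y2 \<noteq> 0 then Y2 else if c Y3 \<noteq> 0 then Y3 else Y4)"

text \<open>Coefficient of y^e in the substitution u := sum_w c_w y_w into a formal Laurent series f(u),
  where each power u^n (n possibly negative) is expanded binomially in nonnegative powers of all
  summands other than the first one c_j y_j:
  (c_j y_j + r)^n = sum_k (n choose k) (c_j y_j)^(n-k) r^k.\<close>
definition laur_lin_coef :: "complex fls \<Rightarrow> (var \<Rightarrow> int) \<Rightarrow> (var \<Rightarrow> int) \<Rightarrow> complex" where
  "laur_lin_coef f c e =
    (let j = lead c; R = Ys - {j}; n = (\<Sum>w\<in>Ys. e w); k = (\<Sum>w\<in>R. e w) in
     if \<forall>w\<in>R. 0 \<le> e w then
        fls_nth f n * ((of_int n :: complex) gchoose nat k) * (of_int (c j)) powi (e j)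
        * (of_nat (fact (nat k)) / (\<Prod>w\<in>R. of_nat (fact (nat (e w)))))
        * (\<Prod>w\<in>R. of_int (c w) ^ nat (e w))
     else 0)"

definition Fser :: "complex fps" where
  "Fser = fps_X / (1 - fps_exp (-1))"

definition Hser :: "complex fls" where
  "Hser = fls_X_inv * fps_to_fls Fser"

text \<open>Normal ordered part :h(e^a x)h(e^b x): = sum_{m,n} :h(m)h(n): e^{-m a - n b} x^{-m-n},
  in the x-variable xv, with a, b linear forms in the y's.\<close>
definition NOpart :: "var \<Rightarrow> (var \<Rightarrow> int) \<Rightarrow> (var \<Rightarrow> int) \<Rightarrow> opser" where
  "NOpart xv a b = (\<lambda>e v.
     if \<forall>w. w \<noteq> xv \<and> w \<notin> Ys \<longrightarrow> e w = 0 then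
       Sum_any (\<lambda>m::int. let n = - e xv - m in
          vscale (expcoef (\<lambda>w. - of_int (m * a w + n * b w)) e) (normord m n v))
     else 0)"

text \<open>Central part d/da (1/(1 - e^{-a+b})), i.e. H'(a-b) with H(u) = 1/(1-e^{-u}),
  expanded by the binomial convention; acts as a multiple of the identity.\<close>
definition Cpart :: "(var \<Rightarrow> int) \<Rightarrow> (var \<Rightarrow> int) \<Rightarrow> opser" where
  "Cpart a b = (\<lambda>e v. if \<forall>w. w \<notin> Ys \<longrightarrow> e w = 0
      then vscale (laur_lin_coef (fls_deriv Hser) (\<lambda>w. a w - b w) e) v else 0)"

definition Lbar :: "var \<Rightarrow> (var \<Rightarrow> int) \<Rightarrow> (var \<Rightarrow> int) \<Rightarrow> opser" where
  "Lbar xv a b = ser_scale (1/2) (ser_sub (NOpart xv a b) (Cpart a b))"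

text \<open>delta(e^{c} x1/x2) = sum_n e^{n c} x1^n x2^{-n}, c a linear form in the y's.\<close>
definition delta_ser :: "(var \<Rightarrow> int) \<Rightarrow> opser" where
  "delta_ser c = scalar_ser (\<lambda>e.
     if (\<forall>w. w \<notin> Ys \<and> w \<noteq> X1 \<and> w \<noteq> X2 \<longrightarrow> e w = 0) \<and> e X2 = - e X1
     then expcoef (\<lambda>w. of_int (e X1 * c w)) e else 0)"

end

theory Submission
  imports Defs "HOL-Library.FuncSet"
begin

text \<open>
  Write \<open>p\<close>, \<open>q\<close> for minus the exponents of \<open>x\<^sub>1\<close>, \<open>x\<^sub>2\<close>. Single contractions in
  \<open>[:h(m)h(p-m):, :h(k)h(q-k):]\<close> leave normal ordered products on the four lines
  \<open>k = -m\<close>, \<open>k = m-p\<close>, \<open>k = q+m\<close>, \<open>k = p+q-m\<close>, which are the four normal ordered terms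
  on the right. Double contractions leave, for \<open>p + q = 0\<close>, finite sums of
  \<open>m (p-m) e\<^bsup>-mP-(p-m)Q\<^esup>\<close> with \<open>P = y\<^sub>1-y\<^sub>3\<close>, \<open>Q = y\<^sub>2-y\<^sub>4\<close>, or the same with
  \<open>y\<^sub>3\<close> and \<open>y\<^sub>4\<close> exchanged. With \<open>H(u) = 1/(1-e\<^bsup>-u\<^esup>)\<close> and \<open>u = P-Q\<close>, such a sum is
  \<open>\<partial>\<^sub>P \<partial>\<^sub>Q\<close> of the geometric sum \<open>(e\<^bsup>-pQ\<^esup> - e\<^bsup>-pP\<^esup>) H(u)\<close>, hence
  \<open>\<partial>\<^sub>P (H'(u) e\<^bsup>-pP\<^esup>) + \<partial>\<^sub>Q (H'(u) e\<^bsup>-pQ\<^esup>)\<close>. Since \<open>H'\<close> is even, these are the central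
  terms on the right, paired so that their poles in \<open>y\<^sub>1\<close> cancel.
\<close>

section \<open>Oscillators and normal ordering\<close>

lemma sum_fun_apply: "(\<Sum>i\<in>A. f i) x = (\<Sum>i\<in>A. f i x)"
  for f :: "'i \<Rightarrow> 'b \<Rightarrow> 'c::comm_monoid_add"
  by (induction A rule: infinite_finite_induct) auto

lemma vscale_zero [simp]: "vscale 0 v = 0" "vscale c 0 = 0"
  by (auto simp: vscale_def)

lemma vscale_vscale [simp]: "vscale a (vscale b v) = vscale (a * b) v"
  by (simp add: vscale_def mult.assoc)

lemma vscale_add_left: "vscale (a + b) v = vscale a v + vscale b v"
  by (auto simp: vscale_def algebra_simps)

lemma vscale_add_right: "vscale a (u + v) = vscale a u + vscale a v"
  by (auto simp: vscale_def algebra_simps)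

lemma vscale_diff_right: "vscale a (u - v) = vscale a u - vscale a v"
  by (auto simp: vscale_def algebra_simps)

lemma vscale_sum_left: "vscale (\<Sum>i\<in>A. f i) v = (\<Sum>i\<in>A. vscale (f i) v)"
  by (auto simp: vscale_def sum_fun_apply sum_distrib_right)

lemma vscale_sum_right: "vscale a (\<Sum>i\<in>A. f i) = (\<Sum>i\<in>A. vscale a (f i))"
  by (auto simp: vscale_def sum_fun_apply sum_distrib_left)

section \<open>Heisenberg relations on the Fock space\<close>

lemma hop_add: "hop n (u + v) = hop n u + hop n v"
  by (auto simp: hop_def algebra_simps)

lemma hop_diff: "hop n (u - v) = hop n u - hop n v"
proof -
  have "hop n (u - v) + hop n v = hop n u"
    by (subst hop_add[symmetric]) simp
  then show ?thesis by (simp add: eq_diff_eq)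
qed

lemma hop_scale: "hop n (vscale c v) = vscale c (hop n v)"
  by (auto simp: hop_def vscale_def)

lemma hop_zero_vec [simp]: "hop n 0 = 0"
  by (auto simp: hop_def)

lemma hop_zero [simp]: "hop 0 v = 0"
  by (auto simp: hop_def)

text \<open>For \<open>n = - m\<close>, annihilating after creating reads off m times (multiplicity
  of m in the monomial, plus one), and the opposite order reads off m times the multiplicity itself.
  The difference is m. For other pairs of indices the two multiset operations do not
  interact.\<close>

lemma hop_comm_pos_neg:
  assumes "m > 0" "n < 0"
  shows "hop m (hop n v) - hop n (hop m v) = vscale (if m + n = 0 then of_int m else 0) v"
proof
  fix \<mu>
  show "(hop m (hop n v) - hop n (hop m v)) \<mu> = vscale (if m + n = 0 then of_int m else 0) v \<mu>"
  proof (cases "m + n = 0")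
    case True
    then have n: "n = - m" by simp
    show ?thesis
      using assms by (cases "nat m \<in># \<mu>")
        (auto simp: n hop_def vscale_def algebra_simps count_eq_zero_iff)
  next
    case False
    then have "nat m \<noteq> nat (-n)" using assms by auto
    then show ?thesis
      using assms False by (auto simp: hop_def vscale_def)
  qed
qed

lemma hop_comm:
  "hop m (hop n v) - hop n (hop m v) = vscale (if m + n = 0 then of_int m else 0) v"
proof -
  consider "m = 0 \<or> n = 0" | "m > 0" "n < 0" | "m < 0" "n > 0" | "m > 0" "n > 0" | "m < 0" "n < 0"
    by linarith
  then show ?thesis
  proof cases
    case 1
    then show ?thesis by auto
  next
    case 2
    then show ?thesis by (rule hop_comm_pos_neg)
  next
    case 3
    have "hop m (hop n v) - hop n (hop m v) = - (hop n (hop m v) - hop m (hop n v))" by simp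
    also have "\<dots> = - vscale (if n + m = 0 then of_int n else 0) v"
      by (subst hop_comm_pos_neg) (use 3 in auto)
    also have "\<dots> = vscale (if m + n = 0 then of_int m else 0) v"
      by (auto simp: vscale_def fun_eq_iff add.commute add_eq_0_iff)
    finally show ?thesis .
  next
    case 4
    then show ?thesis by (auto simp: hop_def fun_eq_iff add_mset_commute)
  next
    case 5
    \<comment> \<open>Two creation operators remove two entries in succession. The condition that
      both can be removed is the same in either order, also for equal indices, where multiplicity
      two is needed.\<close>
    then have "nat (-m) \<in># \<mu> \<and> nat (-n) \<in># \<mu> - {#nat (-m)#} \<longleftrightarrow>
        nat (-n) \<in># \<mu> \<and> nat (-m) \<in># \<mu> - {#nat (-n)#}" for \<mu>
      by (cases "nat (-m) = nat (-n)") (auto dest: in_diffD simp: in_diff_count)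
    moreover have "\<mu> - {#nat (-m)#} - {#nat (-n)#} = \<mu> - {#nat (-n)#} - {#nat (-m)#}" for \<mu>
      by (simp add: diff_diff_add_mset add_mset_commute)
    ultimately show ?thesis using 5 by (auto simp: hop_def fun_eq_iff)
  qed
qed

lemma hop_swap:
  "hop m (hop n v) = hop n (hop m v) + vscale (if m + n = 0 then of_int m else 0) v"
  using hop_comm[of m n v] by (simp add: algebra_simps)

section \<open>Normal ordered pairs and their commutators\<close>

lemma hop_hop_normord:
  "hop m (hop n v) = normord m n v + vscale (if m > 0 \<and> n = - m then of_int m else 0) v"
  by (auto simp: normord_def hop_swap[of m n])

lemma normord_add: "normord m n (u + v) = normord m n u + normord m n v"
  by (simp add: normord_def hop_add)

lemma normord_scale: "normord m n (vscale c v) = vscale c (normord m n v)"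
  by (simp add: normord_def hop_scale)

lemma normord_zero [simp]: "normord m n 0 = 0"
  by (simp add: normord_def)

lemma normord_diff: "normord m n (u - v) = normord m n u - normord m n v"
proof -
  have "normord m n (u - v) + normord m n v = normord m n u"
    by (subst normord_add[symmetric]) simp
  then show ?thesis by (simp add: eq_diff_eq)
qed

lemma normord_sum: "normord m n (\<Sum>i\<in>A. f i) = (\<Sum>i\<in>A. normord m n (f i))"
  by (induction A rule: infinite_finite_induct) (simp_all add: normord_add del: plus_fun_apply zero_fun_apply)

text \<open>Move h(k) and then h(l) to the left across h(n) and h(m). Each crossing leaves one
  contraction, multiplied by the two remaining operators in the order they then have. This order
  decides which double contractions appear in \<open>normord_commutator\<close>.\<close>

lemma hop_hop_comm:
  "hop m (hop n (hop k (hop l v))) - hop k (hop l (hop m (hop n v))) =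
     vscale (if n + k = 0 then of_int n else 0) (hop m (hop l v))
   + vscale (if m + k = 0 then of_int m else 0) (hop n (hop l v))
   + vscale (if n + l = 0 then of_int n else 0) (hop k (hop m v))
   + vscale (if m + l = 0 then of_int m else 0) (hop k (hop n v))"
proof -
  have "hop m (hop n (hop k (hop l v))) = hop m (hop k (hop n (hop l v)))
      + vscale (if n + k = 0 then of_int n else 0) (hop m (hop l v))"
    by (subst hop_swap[of n k]) (simp add: hop_add hop_scale)
  moreover have "hop m (hop k (hop n (hop l v))) = hop k (hop m (hop n (hop l v)))
      + vscale (if m + k = 0 then of_int m else 0) (hop n (hop l v))"
    by (rule hop_swap)
  moreover have "hop k (hop m (hop n (hop l v))) = hop k (hop m (hop l (hop n v)))
      + vscale (if n + l = 0 then of_int n else 0) (hop k (hop m v))"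
    by (subst hop_swap[of n l]) (simp add: hop_add hop_scale)
  moreover have "hop k (hop m (hop l (hop n v))) = hop k (hop l (hop m (hop n v)))
      + vscale (if m + l = 0 then of_int m else 0) (hop k (hop n v))"
    by (subst hop_swap[of m l]) (simp add: hop_add hop_scale)
  ultimately show ?thesis by (simp add: algebra_simps)
qed

lemma normord_commute: "normord m n = normord n m"
proof
  fix v
  show "normord m n v = normord n m v"
    using hop_swap[of m n v] by (cases "m = 0") (auto simp: normord_def)
qed

text \<open>The scalar left by contracting both pairs of factors.\<close>
definition central_weight :: "int \<Rightarrow> int \<Rightarrow> complex" where
  "central_weight m n = of_int (m * n) * (of_bool (m > 0) - of_bool (n < 0))"

text \<open>Normal ordering changes a pair by a scalar, so the commutator is that of the plain
  products. Putting the remaining pairs of \<open>hop_hop_comm\<close> back into normal order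
  produces the double contractions.\<close>

lemma normord_commutator:
  "normord m n (normord k l v) - normord k l (normord m n v) =
     vscale (if n + k = 0 then of_int n else 0) (normord m l v)
   + vscale (if m + k = 0 then of_int m else 0) (normord n l v)
   + vscale (if n + l = 0 then of_int n else 0) (normord m k v)
   + vscale (if m + l = 0 then of_int m else 0) (normord n k v)
   + vscale (if n + k = 0 \<and> m + l = 0 then central_weight m n else 0) v
   + vscale (if m + k = 0 \<and> n + l = 0 then central_weight m n else 0) v"
  (is "?L = ?R")
proof -
  have "?L = hop m (hop n (hop k (hop l v))) - hop k (hop l (hop m (hop n v)))"
  proof -
    define a :: complex where "a = (if m > 0 \<and> n = - m then of_int m else 0)"
    define b :: complex where "b = (if k > 0 \<and> l = - k then of_int k else 0)"
    have 1: "hop m (hop n u) = normord m n u + vscale a u" for u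
      unfolding a_def by (rule hop_hop_normord)
    have 2: "hop k (hop l u) = normord k l u + vscale b u" for u
      unfolding b_def by (rule hop_hop_normord)
    show ?thesis
      unfolding 1 2 
      by (simp add: normord_add normord_scale vscale_add_right mult.commute)
  qed
  also have "\<dots> = ?R"
  proof -
    \<comment> \<open>The first and fourth products belong to the pattern k = -n, l = -m, the second
      and third to k = -m, l = -n. Both give the same weight because [n > 0] - [m < 0] = [m > 0] -
      [n < 0] for nonzero m and n.\<close>
    have "(if n + k = 0 then of_int n else 0 :: complex) * (if m > 0 \<and> l = - m then of_int m else 0)
        + (if m + k = 0 then of_int m else 0) * (if n > 0 \<and> l = - n then of_int n else 0)
        + (if n + l = 0 then of_int n else 0) * (if k > 0 \<and> m = - k then of_int k else 0)
        + (if m + l = 0 then of_int m else 0) * (if k > 0 \<and> n = - k then of_int k else 0)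
        = (if n + k = 0 \<and> m + l = 0 then central_weight m n else 0)
        + (if m + k = 0 \<and> n + l = 0 then central_weight m n else 0)"
      by (cases "k = - n"; cases "l = - m"; cases "k = - m"; cases "l = - n";
          cases n "0 :: int" rule: linorder_cases; cases m "0 :: int" rule: linorder_cases;
          simp add: central_weight_def)
    moreover have "vscale a1 (w1 + vscale b1 v) + vscale a2 (w2 + vscale b2 v)
        + vscale a3 (w3 + vscale b3 v) + vscale a4 (w4 + vscale b4 v)
        = vscale a1 w1 + vscale a2 w2 + vscale a3 w3 + vscale a4 w4 + vscale z1 v + vscale z2 v"
      if "a1 * b1 + a2 * b2 + a3 * b3 + a4 * b4 = z1 + z2"
      for a1 a2 a3 a4 b1 b2 b3 b4 z1 z2 w1 w2 w3 w4
      using arg_cong[OF that, of "\<lambda>c. vscale c v"]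
      by (simp add: vscale_add_right vscale_add_left add_ac)
    ultimately show ?thesis
      unfolding hop_hop_comm unfolding hop_hop_normord normord_commute[of k] by blast
  qed
  finally show ?thesis .
qed

section \<open>Quadratic operators\<close>

text \<open>The form in which finite support of a vector is used: it bounds the modes that act
  nontrivially, and it passes to the images of v under the operators below, with an explicit
  bound.\<close>

definition annihilated_above :: "int \<Rightarrow> vec \<Rightarrow> bool" where
  "annihilated_above N v \<longleftrightarrow> (\<forall>n>N. hop n v = 0)"

lemma fock_vec_annihilated_above:
  assumes "fock_vec v"
  obtains N where "N \<ge> 0" "annihilated_above N v"
proof
  \<comment> \<open>The bound is the largest index occurring in v; the extra 0 keeps the set
    nonempty when v is constant or zero.\<close>
  define U where "U = insert 0 (\<Union>\<mu>\<in>{\<mu>. v \<mu> \<noteq> 0}. set_mset \<mu>)"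
  have fin: "finite U" using assms by (auto simp: fock_vec_def U_def)
  show "int (Max U) \<ge> 0" by simp
  show "annihilated_above (int (Max U)) v"
    unfolding annihilated_above_def
  proof (intro allI impI)
    fix n assume n: "n > int (Max U)"
    have "v (add_mset (nat n) \<mu>) = 0" for \<mu>
    proof (rule ccontr)
      assume "v (add_mset (nat n) \<mu>) \<noteq> 0"
      then have "nat n \<in> U" by (force simp: U_def)
      with fin have "nat n \<le> Max U" by simp
      with n show False by linarith
    qed
    with n show "hop n v = 0" by (auto simp: hop_def)
  qed
qed

lemma annihilated_above_mono:
  "annihilated_above N v \<Longrightarrow> N \<le> N' \<Longrightarrow> annihilated_above N' v"
  by (auto simp: annihilated_above_def)

lemma annihilated_above_scale: "annihilated_above N v \<Longrightarrow> annihilated_above N (vscale c v)"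
  by (simp add: annihilated_above_def hop_scale)

lemma annihilated_above_sum:
  assumes "\<And>i. i \<in> A \<Longrightarrow> annihilated_above N (f i)"
  shows "annihilated_above N (\<Sum>i\<in>A. f i)"
  using assms
  by (induction A rule: infinite_finite_induct)
    (simp_all add: annihilated_above_def hop_add del: plus_fun_apply zero_fun_apply)

text \<open>A mode above N commutes with h(k) when k is at least -N, since their indices cannot add
  up to 0.\<close>

lemma annihilated_above_hop:
  assumes "annihilated_above N v" "\<bar>k\<bar> \<le> N"
  shows "annihilated_above N (hop k v)"
  using assms by (auto simp: annihilated_above_def hop_swap[of _ k])

lemma annihilated_above_normord:
  assumes "annihilated_above N v" "\<bar>k\<bar> \<le> N" "\<bar>l\<bar> \<le> N"
  shows "annihilated_above N (normord k l v)"
  using assms by (simp add: normord_def annihilated_above_hop)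

text \<open>The factor with large index m can be made to act first: normal ordering places it there
  if the other index is negative, and otherwise the two factors commute because m + n > 0.\<close>

lemma normord_eq_0:
  assumes "annihilated_above N v" "N \<ge> 0" "m > N \<or> n > N"
  shows "normord m n v = 0"
proof -
  have *: "normord m n v = 0" if "m > N" for m n
  proof (cases "n < 0")
    case True
    then show ?thesis using that assms by (simp add: normord_def annihilated_above_def)
  next
    case False
    then have "hop m (hop n v) = hop n (hop m v)"
      using that assms by (simp add: hop_swap[of m n])
    then show ?thesis using that assms False by (simp add: normord_def annihilated_above_def)
  qed
  from assms(3) show ?thesis
    using *[of m n] *[of n m] by (auto simp: normord_commute[of n m])
qed

text \<open>The coefficient of a normal ordered part at a fixed exponent vector has this form, with
  exponential coefficients as C (see \<open>NOpart_eq\<close>). Keeping C arbitrary separates the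
  oscillator algebra from the formal variables.\<close>

definition quad :: "(int \<Rightarrow> complex) \<Rightarrow> int \<Rightarrow> op" where
  "quad C s v = Sum_any (\<lambda>m. vscale (C m) (normord m (s - m) v))"

text \<open>A summand survives only if m and s - m are both at most N, which confines m to an
  interval. Any larger B is allowed, so that several sums can share one range.\<close>

lemma quad_eq_sum:
  assumes "annihilated_above N v" "N \<ge> 0" "B \<ge> N + \<bar>s\<bar>"
  shows "quad C s v = (\<Sum>m\<in>{-B..B}. vscale (C m) (normord m (s - m) v))"
  unfolding quad_def
proof (rule Sum_any.expand_superset)
  show "{m. vscale (C m) (normord m (s - m) v) \<noteq> 0} \<subseteq> {-B..B}"
  proof
    fix m assume "m \<in> {m. vscale (C m) (normord m (s - m) v) \<noteq> 0}"
    then have "normord m (s - m) v \<noteq> 0" by auto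
    then have "m \<le> N" "s - m \<le> N" using normord_eq_0[OF assms(1,2), of m "s - m"] by auto
    then show "m \<in> {-B..B}" using assms by auto
  qed
qed simp

text \<open>For nonzero c the support of the summands does not change, so the scalar comes out even
  where that support is infinite and \<open>Sum_any\<close> has its default value 0. The case c = 0
  is separate.\<close>

lemma quad_scale:
  "quad C s (vscale c v) = vscale c (quad C s v)"
proof (cases "c = 0")
  case True
  have "quad C s 0 = 0" by (simp add: quad_def)
  with True show ?thesis by simp
next
  case False
  let ?f = "\<lambda>m. vscale (C m) (normord m (s - m) v)"
  have eq0: "vscale c u = 0 \<longleftrightarrow> u = 0" for u
    using False by (auto simp: vscale_def fun_eq_iff)
  have "quad C s (vscale c v) = Sum_any (\<lambda>m. vscale c (?f m))"
    unfolding quad_def by (simp add: normord_scale mult.commute)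
  also have "\<dots> = vscale c (Sum_any ?f)"
    unfolding Sum_any.expand_set by (simp only: eq0 vscale_sum_right)
  finally show ?thesis by (simp add: quad_def)
qed

text \<open>The surviving summands have both indices between -(N + |s|) and N, so each of them
  respects the enlarged bound.\<close>

lemma annihilated_above_quad:
  assumes ann: "annihilated_above N v" and N: "N \<ge> 0"
  shows "annihilated_above (N + 2 * \<bar>s\<bar>) (quad C s v)"
  unfolding quad_eq_sum[OF assms order.refl]
proof (intro annihilated_above_sum annihilated_above_scale)
  fix m
  show "annihilated_above (N + 2 * \<bar>s\<bar>) (normord m (s - m) v)"
  proof (cases "m > N \<or> s - m > N")
    case True
    then show ?thesis using normord_eq_0[OF ann N True] by (simp add: annihilated_above_def)
  next
    case False
    then show ?thesis
      using N by (intro annihilated_above_normord annihilated_above_mono[OF ann]) auto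
  qed
qed

lemma quad_cmult:
  assumes "annihilated_above N v" "N \<ge> 0"
  shows "vscale c (quad C s v) = quad (\<lambda>m. c * C m) s v"
  by (simp add: quad_eq_sum[OF assms order.refl] vscale_sum_right)

lemma quad_diff:
  assumes "annihilated_above N u" "annihilated_above N v" "N \<ge> 0"
  shows "quad C s (u - v) = quad C s u - quad C s v"
proof -
  have "annihilated_above N (u - v)"
    using assms(1,2) by (simp add: annihilated_above_def hop_diff)
  then show ?thesis
    using assms by (simp add: quad_eq_sum[OF _ _ order.refl] normord_diff vscale_diff_right sum_subtractf)
qed

text \<open>A single contraction restricts a double sum to a line. The involution renames the outer
  index so that the surviving factor is h of the new index, and the range \<open>I\<close> contains
  both coordinates of every nonzero point of the line.\<close>

lemma double_sum_line:
  fixes F :: "int \<Rightarrow> vec"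
  assumes "finite I" "\<And>m. \<alpha> (\<alpha> m) = m"
    and "\<And>j. F j \<noteq> 0 \<Longrightarrow> \<alpha> j \<in> I \<and> b j \<in> I"
  shows "(\<Sum>m\<in>I. \<Sum>k\<in>I. if k = b (\<alpha> m) then F (\<alpha> m) else 0) = Sum_any F"
proof -
  have "bij \<alpha>" using assms(2) by (metis bijI')
  have "(\<Sum>k\<in>I. if k = b (\<alpha> m) then F (\<alpha> m) else 0) = F (\<alpha> m)" for m
    using assms(1,3) by (auto simp: sum.delta simp del: zero_fun_apply)
  then have "(\<Sum>m\<in>I. \<Sum>k\<in>I. if k = b (\<alpha> m) then F (\<alpha> m) else 0) = (\<Sum>m\<in>I. F (\<alpha> m))"
    by simp
  also have "\<dots> = Sum_any (\<lambda>m. F (\<alpha> m))"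
    by (rule Sum_any.expand_superset[symmetric]) (use assms in \<open>auto, metis\<close>)
  also have "\<dots> = Sum_any F"
    using \<open>bij \<alpha>\<close> by (intro Sum_any.reindex_cong[symmetric]) auto
  finally show ?thesis .
qed

text \<open>The sum over m from 0 to p - 1 with the usual sign convention for negative p, the same
  as in \<open>geometric_Hser\<close>.\<close>

definition central_sum :: "int \<Rightarrow> (int \<Rightarrow> complex) \<Rightarrow> complex" where
  "central_sum p f = (\<Sum>m\<in>{0..<p}. of_int (m * (p - m)) * f m)
                   - (\<Sum>m\<in>{p..<0}. of_int (m * (p - m)) * f m)"

lemma central_sum_add: "central_sum p f + central_sum p g = central_sum p (\<lambda>m. f m + g m)"
  by (simp add: central_sum_def sum.distrib distrib_left)

text \<open>The bracket [m > 0] - [p - m < 0] is 1 for 0 < m <= p, is -1 for p < m <= 0, and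
  vanishes elsewhere. At m = 0 and m = p the factor m (p - m) is zero, so half-open intervals may be
  used.\<close>

lemma sum_central_weight:
  assumes "B \<ge> \<bar>p\<bar>"
  shows "(\<Sum>m\<in>{-B..B}. central_weight m (p - m) * f m) = central_sum p f"
proof (cases "p \<ge> 0")
  case True
  have "(\<Sum>m\<in>{-B..B}. central_weight m (p - m) * f m)
      = (\<Sum>m\<in>{0..<p}. of_int (m * (p - m)) * f m)"
    using True assms by (intro sum.mono_neutral_cong_right) (auto simp: central_weight_def)
  with True show ?thesis by (simp add: central_sum_def)
next
  case False
  have "(\<Sum>m\<in>{-B..B}. central_weight m (p - m) * f m)
      = (\<Sum>m\<in>{p..<0}. - (of_int (m * (p - m)) * f m))"
    using False assms by (intro sum.mono_neutral_cong_right) (auto simp: central_weight_def)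
  with False show ?thesis by (simp add: central_sum_def sum_negf)
qed

text \<open>Both compositions are written as sums over one finite square, where
  \<open>normord_commutator\<close> applies termwise. The four single contractions then collapse to
  lines and the two double contractions to finite scalar sums.\<close>

lemma quad_commutator:
  assumes ann: "annihilated_above N v" and N: "N \<ge> 0"
  shows "quad C p (quad D q v) - quad D q (quad C p v) =
      quad (\<lambda>m. of_int (p - m) * C m * D (m - p)) (p + q) v
    + quad (\<lambda>m. of_int (p - m) * C (p - m) * D (m - p)) (p + q) v
    + quad (\<lambda>m. of_int (p - m) * C m * D (p + q - m)) (p + q) v
    + quad (\<lambda>m. of_int (p - m) * C (p - m) * D (p + q - m)) (p + q) v
    + vscale (if p + q = 0 then central_sum p (\<lambda>m. C m * (D (m - p) + D (- m))) else 0) v"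
proof -
  \<comment> \<open>\<open>N'\<close> bounds the modes acting on the inner images as well as on v,
    and \<open>B\<close> is then a valid range for both modes p and q in either order of
    composition.\<close>
  define N' where "N' = N + 2 * \<bar>p\<bar> + 2 * \<bar>q\<bar>"
  define B where "B = N' + \<bar>p\<bar> + \<bar>q\<bar>"
  let ?I = "{-B..B}"
  have qv: "quad C s v = (\<Sum>m\<in>?I. vscale (C m) (normord m (s - m) v))"
    if "s \<in> {p, q}" for C s
    by (rule quad_eq_sum[OF ann N]) (use that in \<open>auto simp: B_def N'_def\<close>)
  have ann_quad: "annihilated_above N' (quad C s v)" if "s \<in> {p, q}" for C s
    by (rule annihilated_above_mono[OF annihilated_above_quad[OF ann N]])
      (use that in \<open>auto simp: N'_def\<close>)
  have qq: "quad C s (quad D t v) =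
      (\<Sum>m\<in>?I. \<Sum>k\<in>?I. vscale (C m * D k) (normord m (s - m) (normord k (t - k) v)))"
    if "s \<in> {p, q}" "t \<in> {p, q}" for C D s t
  proof -
    have "quad C s (quad D t v) = (\<Sum>m\<in>?I. vscale (C m) (normord m (s - m) (quad D t v)))"
      by (rule quad_eq_sum[OF ann_quad]) (use that N in \<open>auto simp: B_def N'_def\<close>)
    then show ?thesis
      by (simp add: qv[OF that(2)] normord_sum normord_scale vscale_sum_right)
  qed
  have line: "(\<Sum>m\<in>?I. \<Sum>k\<in>?I. if k = b (\<alpha> m)
        then vscale (E (\<alpha> m)) (normord (\<alpha> m) (p + q - \<alpha> m) v) else 0) = quad E (p + q) v"
    if "\<And>m. \<alpha> (\<alpha> m) = m" "\<alpha> = (\<lambda>m. m) \<or> \<alpha> = (\<lambda>m. p - m)"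
      "b = (\<lambda>m. m - p) \<or> b = (\<lambda>m. p + q - m)"
    for \<alpha> b E
    unfolding quad_def
  proof (rule double_sum_line)
    fix j assume "vscale (E j) (normord j (p + q - j) v) \<noteq> 0"
    then have "normord j (p + q - j) v \<noteq> 0" by auto
    then have "j \<le> N" "p + q - j \<le> N" using normord_eq_0[OF ann N, of j "p + q - j"] by auto
    then show "\<alpha> j \<in> ?I \<and> b j \<in> ?I"
      using that(2,3) N by (auto simp: B_def N'_def)
  qed (use that in auto)
  define S where "S T = (\<Sum>m\<in>?I. \<Sum>k\<in>?I. T m k)" for T :: "int \<Rightarrow> int \<Rightarrow> vec"
  have S_add: "S (\<lambda>m k. T m k + T' m k) = S T + S T'" for T T'
    by (simp add: S_def sum.distrib)
  have S1: "S (\<lambda>m k. vscale (C m * D k * (if (p - m) + k = 0 then of_int (p - m) else 0))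
        (normord m (q - k) v)) = quad (\<lambda>m. of_int (p - m) * C m * D (m - p)) (p + q) v"
    unfolding S_def
    by (subst line[of "\<lambda>m. m" "\<lambda>m. m - p", symmetric])
      (auto intro!: sum.cong simp: algebra_simps simp del: zero_fun_apply sum.delta sum.delta')
  \<comment> \<open>Here h(m) is contracted and h(p - m) survives. Renaming m to p - m gives this
    line the weight p - m of the first one; \<open>S4\<close> is treated alike.\<close>
  have S2: "S (\<lambda>m k. vscale (C m * D k * (if m + k = 0 then of_int m else 0))
        (normord (p - m) (q - k) v)) = quad (\<lambda>m. of_int (p - m) * C (p - m) * D (m - p)) (p + q) v"
    unfolding S_def
    by (subst line[of "\<lambda>m. p - m" "\<lambda>m. m - p", symmetric])
      (auto intro!: sum.cong simp: algebra_simps add_eq_0_iff simp del: zero_fun_apply sum.delta sum.delta')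
  have S3: "S (\<lambda>m k. vscale (C m * D k * (if (p - m) + (q - k) = 0 then of_int (p - m) else 0))
        (normord m k v)) = quad (\<lambda>m. of_int (p - m) * C m * D (p + q - m)) (p + q) v"
  proof -
    have eq: "(p - m) + (q - k) = 0 \<longleftrightarrow> k = p + q - m" for m k by auto
    show ?thesis
      unfolding S_def eq
      by (subst line[of "\<lambda>m. m" "\<lambda>m. p + q - m", symmetric])
        (auto intro!: sum.cong simp: mult_ac simp del: zero_fun_apply sum.delta sum.delta')
  qed
  have S4: "S (\<lambda>m k. vscale (C m * D k * (if m + (q - k) = 0 then of_int m else 0))
        (normord (p - m) k v)) = quad (\<lambda>m. of_int (p - m) * C (p - m) * D (p + q - m)) (p + q) v"
  proof -
    have eq: "m + (q - k) = 0 \<longleftrightarrow> k = p + q - (p - m)" for m k by auto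
    show ?thesis
      unfolding S_def eq
      by (subst line[of "\<lambda>m. p - m" "\<lambda>m. p + q - m", symmetric])
        (auto intro!: sum.cong simp: mult_ac simp del: zero_fun_apply sum.delta sum.delta')
  qed
  have S5: "S (\<lambda>m k. vscale (C m * D k *
        (if (p - m) + k = 0 \<and> m + (q - k) = 0 then central_weight m (p - m) else 0)) v)
      = vscale (if p + q = 0 then central_sum p (\<lambda>m. C m * D (m - p)) else 0) v"
  proof (cases "p + q = 0")
    case True
    have "(\<Sum>k\<in>?I. C m * D k * (if (p - m) + k = 0 \<and> m + (q - k) = 0 then central_weight m (p - m) else 0))
        = central_weight m (p - m) * (C m * D (m - p))" if "m \<in> ?I" for m
    proof -
      have "(\<Sum>k\<in>?I. C m * D k * (if (p - m) + k = 0 \<and> m + (q - k) = 0 then central_weight m (p - m) else 0))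
          = (\<Sum>k\<in>?I. if k = m - p then central_weight m (p - m) * (C m * D (m - p)) else 0)"
        using True by (intro sum.cong) auto
      also have "\<dots> = central_weight m (p - m) * (C m * D (m - p))"
      \<comment> \<open>The edge of the square costs nothing: a nonzero weight forces m to lie
        between 0 and p, and then m - p is within range.\<close>
      proof (cases "m - p \<in> ?I")
        case False
        then have "central_weight m (p - m) = 0"
          using that N by (auto simp: central_weight_def B_def N'_def)
        then show ?thesis by simp
      qed (simp add: sum.delta)
      finally show ?thesis .
    qed
    then have "(\<Sum>m\<in>?I. \<Sum>k\<in>?I. C m * D k * (if (p - m) + k = 0 \<and> m + (q - k) = 0 then central_weight m (p - m) else 0))
        = (\<Sum>m\<in>?I. central_weight m (p - m) * (C m * D (m - p)))"
      by (rule sum.cong[OF refl])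
    also have "\<dots> = central_sum p (\<lambda>m. C m * D (m - p))"
      by (rule sum_central_weight) (use N in \<open>simp add: B_def N'_def\<close>)
    finally show ?thesis
      unfolding S_def vscale_sum_left[symmetric] using True by simp
  qed (auto simp: S_def intro!: sum.neutral)
  have S6: "S (\<lambda>m k. vscale (C m * D k *
        (if m + k = 0 \<and> (p - m) + (q - k) = 0 then central_weight m (p - m) else 0)) v)
      = vscale (if p + q = 0 then central_sum p (\<lambda>m. C m * D (- m)) else 0) v"
  proof (cases "p + q = 0")
    case True
    have "(\<Sum>k\<in>?I. C m * D k * (if m + k = 0 \<and> (p - m) + (q - k) = 0 then central_weight m (p - m) else 0))
        = central_weight m (p - m) * (C m * D (- m))" if "m \<in> ?I" for m
    proof -
      have "(\<Sum>k\<in>?I. C m * D k * (if m + k = 0 \<and> (p - m) + (q - k) = 0 then central_weight m (p - m) else 0))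
          = (\<Sum>k\<in>?I. if k = - m then central_weight m (p - m) * (C m * D (- m)) else 0)"
        using True by (intro sum.cong) auto
      also have "\<dots> = central_weight m (p - m) * (C m * D (- m))"
      proof (cases "- m \<in> ?I")
        case False
        then have "central_weight m (p - m) = 0"
          using that N by (auto simp: central_weight_def B_def N'_def)
        then show ?thesis by simp
      qed (simp add: sum.delta)
      finally show ?thesis .
    qed
    then have "(\<Sum>m\<in>?I. \<Sum>k\<in>?I. C m * D k * (if m + k = 0 \<and> (p - m) + (q - k) = 0 then central_weight m (p - m) else 0))
        = (\<Sum>m\<in>?I. central_weight m (p - m) * (C m * D (- m)))"
      by (rule sum.cong[OF refl])
    also have "\<dots> = central_sum p (\<lambda>m. C m * D (- m))"
      by (rule sum_central_weight) (use N in \<open>simp add: B_def N'_def\<close>)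
    finally show ?thesis
      unfolding S_def vscale_sum_left[symmetric] using True by simp
  qed (auto simp: S_def intro!: sum.neutral)
  have "quad C p (quad D q v) - quad D q (quad C p v) =
      S (\<lambda>m k. vscale (C m * D k) (normord m (p - m) (normord k (q - k) v)))
    - S (\<lambda>m k. vscale (C m * D k) (normord k (q - k) (normord m (p - m) v)))"
    unfolding S_def qq[of p q C D, simplified] qq[of q p D C, simplified]
    by (subst (3) sum.swap) (simp add: mult.commute)
  also have "\<dots> = S (\<lambda>m k. vscale (C m * D k) (normord m (p - m) (normord k (q - k) v)
       - normord k (q - k) (normord m (p - m) v)))"
    by (simp add: S_def sum_subtractf vscale_diff_right)
  also have "\<dots> = quad (\<lambda>m. of_int (p - m) * C m * D (m - p)) (p + q) v
    + quad (\<lambda>m. of_int (p - m) * C (p - m) * D (m - p)) (p + q) v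
    + quad (\<lambda>m. of_int (p - m) * C m * D (p + q - m)) (p + q) v
    + quad (\<lambda>m. of_int (p - m) * C (p - m) * D (p + q - m)) (p + q) v
    + vscale (if p + q = 0 then central_sum p (\<lambda>m. C m * D (m - p)) else 0) v
    + vscale (if p + q = 0 then central_sum p (\<lambda>m. C m * D (- m)) else 0) v"
    unfolding normord_commutator vscale_add_right vscale_vscale S_add S1 S2 S3 S4 S5 S6 ..
  finally have main: "quad C p (quad D q v) - quad D q (quad C p v) = \<dots>" .
  have central: "vscale (if p + q = 0 then central_sum p (\<lambda>m. C m * D (m - p)) else 0) v
    + vscale (if p + q = 0 then central_sum p (\<lambda>m. C m * D (- m)) else 0) v
    = vscale (if p + q = 0 then central_sum p (\<lambda>m. C m * (D (m - p) + D (- m))) else 0) v"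
    by (simp add: vscale_add_left[symmetric] central_sum_add distrib_left)
  show ?thesis unfolding main by (simp only: add.assoc central)
qed

text \<open>Scalar parts drop out of the commutator. Additivity of \<open>quad\<close> needs a
  common bound for the two vectors that are subtracted, which is what the hypotheses supply.\<close>

lemma quad_minus_scalar_commutator:
  assumes "annihilated_above N v" "N \<ge> 0"
  shows "vscale (1/2) (quad C p (vscale (1/2) (quad D q v - vscale b v)) - vscale a (vscale (1/2) (quad D q v - vscale b v)))
    - vscale (1/2) (quad D q (vscale (1/2) (quad C p v - vscale a v)) - vscale b (vscale (1/2) (quad C p v - vscale a v)))
    = vscale (1/4) (quad C p (quad D q v) - quad D q (quad C p v))"
proof -
  have *: "quad C p (quad D q v - vscale b v) = quad C p (quad D q v) - vscale b (quad C p v)" for C D p q b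
  proof -
    have "annihilated_above (N + 2 * \<bar>q\<bar>) (vscale b v)"
      by (intro annihilated_above_scale annihilated_above_mono[OF assms(1)]) simp
    from quad_diff[OF annihilated_above_quad[OF assms] this] assms(2)
    show ?thesis by (simp add: quad_scale)
  qed
  show ?thesis
    unfolding quad_scale * by (auto simp: vscale_def algebra_simps)
qed

section \<open>Products of scalar series with exponentials\<close>

lemma UNIV_var: "(UNIV :: var set) = {X1, X2, Y1, Y2, Y3, Y4}"
  using var.exhaust by auto

lemma all_var: "(\<forall>w. P w) \<longleftrightarrow> P X1 \<and> P X2 \<and> P Y1 \<and> P Y2 \<and> P Y3 \<and> P Y4"
  by (metis var.exhaust)

lemma var_fun_eq_iff:
  "g = h \<longleftrightarrow> g X1 = h X1 \<and> g X2 = h X2 \<and> g Y1 = h Y1 \<and> g Y2 = h Y2 \<and> g Y3 = h Y3 \<and> g Y4 = h Y4"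
  for g h :: "var \<Rightarrow> 'a"
  by (auto simp: fun_eq_iff all_var)

lemma finite_bounded_exponents: "finite {g :: var \<Rightarrow> int. \<forall>w. g w \<in> {-K..K}}"
proof -
  have "{g :: var \<Rightarrow> int. \<forall>w. g w \<in> {-K..K}} = PiE UNIV (\<lambda>_. {-K..K})"
    by (auto simp: PiE_def extensional_def Pi_def)
  moreover have "finite (PiE (UNIV :: var set) (\<lambda>_. {-K..K}))"
    by (rule finite_PiE) (auto simp: UNIV_var)
  ultimately show ?thesis by simp
qed

section \<open>Exponentials and Laurent series of linear forms\<close>

definition exp_term :: "complex \<Rightarrow> int \<Rightarrow> complex" where
  "exp_term a n = (if 0 \<le> n then a ^ nat n / fact (nat n) else 0)"

lemma exp_term_simps [simp]: "exp_term a 0 = 1" "n < 0 \<Longrightarrow> exp_term a n = 0"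
  by (auto simp: exp_term_def)

lemma exp_term_zero: "exp_term 0 n = (if n = 0 then 1 else 0)"
  by (auto simp: exp_term_def)

text \<open>The differential equation of e^{ay}. Extension by zero makes it valid for all integers;
  at n = -1 the left side vanishes through the factor n + 1.\<close>

lemma exp_term_Suc: "of_int (n + 1) * exp_term a (n + 1) = a * exp_term a n"
proof (cases "n \<ge> 0")
  case True
  then have "nat (n + 1) = Suc (nat n)" by simp
  moreover have "of_int (n + 1) = (of_nat (Suc (nat n)) :: complex)" using True by simp
  ultimately show ?thesis using True by (simp add: exp_term_def del: of_nat_Suc)
next
  case False
  then have "n = -1 \<or> n + 1 < 0" by linarith
  then show ?thesis using False by auto
qed

lemma expcoef_eq:
  "expcoef c e = exp_term (c Y1) (e Y1) * exp_term (c Y2) (e Y2) * exp_term (c Y3) (e Y3) * exp_term (c Y4) (e Y4)"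
  by (auto simp: expcoef_def Ys_def exp_term_def mult_ac)

lemma expcoef_eq_0: "w \<in> Ys \<Longrightarrow> e w < 0 \<Longrightarrow> expcoef c e = 0"
  by (auto simp: expcoef_def)

lemma expcoef_eq_0_coeff: "w \<in> Ys \<Longrightarrow> c w = 0 \<Longrightarrow> e w \<noteq> 0 \<Longrightarrow> expcoef c e = 0"
  by (auto simp: expcoef_eq exp_term_zero Ys_def)

lemma expcoef_deriv:
  assumes "w \<in> Ys"
  shows "of_int (e w + 1) * expcoef c (e(w := e w + 1)) = c w * expcoef c e"
proof -
  define O' where "O' = (\<Prod>u\<in>Ys - {w}. exp_term (c u) (e u))"
  have "expcoef c (e(w := e w + 1)) = exp_term (c w) (e w + 1) * O'"
    "expcoef c e = exp_term (c w) (e w) * O'"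
    using assms by (auto simp: expcoef_eq O'_def Ys_def insert_Diff_if mult_ac)
  then show ?thesis by (simp only: mult.assoc[symmetric] exp_term_Suc)
qed

lemma expcoef_diff_le: "expcoef d (\<lambda>w. e w - g w) \<noteq> 0 \<Longrightarrow> w \<in> Ys \<Longrightarrow> g w \<le> e w"
  by (force simp: expcoef_def split: if_splits)

text \<open>The multinomial factor is split: k! joins the binomial to form a falling factorial, and
  the remaining factors become \<open>exp_term\<close>s, whose zeros at negative exponents replace
  the case distinction of the definition.\<close>

lemma laur_lin_coef_eq:
  assumes "c Y1 \<noteq> 0"
  shows "laur_lin_coef f c e = fls_nth f (e Y1 + e Y2 + e Y3 + e Y4)
     * ((of_int (e Y1 + e Y2 + e Y3 + e Y4) gchoose nat (e Y2 + e Y3 + e Y4)) * fact (nat (e Y2 + e Y3 + e Y4)))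
     * of_int (c Y1) powi e Y1
     * (exp_term (of_int (c Y2)) (e Y2) * exp_term (of_int (c Y3)) (e Y3) * exp_term (of_int (c Y4)) (e Y4))"
proof -
  have "lead c = Y1" "Ys - {Y1} = {Y2, Y3, Y4}" using assms by (auto simp: lead_def Ys_def)
  then show ?thesis
    by (auto simp: laur_lin_coef_def exp_term_def Let_def Ys_def field_simps)
qed

lemma laur_lin_coef_eq_0_coeff:
  assumes "w \<in> Ys" "c w = 0" "lead c \<noteq> w" "e w \<noteq> 0"
  shows "laur_lin_coef f c e = 0"
proof (cases "\<forall>u\<in>Ys - {lead c}. 0 \<le> e u")
  case True
  then have "0 \<le> e w" using assms by auto
  then have "(of_int (c w) :: complex) ^ nat (e w) = 0" using assms by (auto simp: power_0_left)
  then have "(\<Prod>u\<in>Ys - {lead c}. (of_int (c u) :: complex) ^ nat (e u)) = 0"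
    using assms by (intro prod_zero) (auto simp: Ys_def)
  then show ?thesis by (simp add: laur_lin_coef_def Let_def)
qed (auto simp: laur_lin_coef_def Let_def)

text \<open>The chain rule survives the binomial expansion. For the leading variable it is the
  identity (n + 1 - k) (n+1 choose k) = (n + 1) (n choose k), for the others the absorption
  identity.\<close>

lemma laur_lin_coef_deriv:
  assumes "c Y1 \<noteq> 0" "w \<in> Ys"
  shows "of_int (e w + 1) * laur_lin_coef f c (e(w := e w + 1))
       = of_int (c w) * laur_lin_coef (fls_deriv f) c e"
proof -
  define n k where "n = e Y1 + e Y2 + e Y3 + e Y4" and "k = e Y2 + e Y3 + e Y4"
  let ?E = "\<lambda>w. exp_term (of_int (c w)) (e w)"
  let ?ff = "\<lambda>n k. (of_int n gchoose nat k) * fact (nat k) :: complex"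
  have R: "fls_nth f (n + 1) * ?ff (n + 1) (k + 1) = fls_nth (fls_deriv f) n * ?ff n k" if "k \<ge> 0"
  proof -
    have k: "nat (k + 1) = Suc (nat k)" using that by simp
    have "?ff (n + 1) (k + 1) = of_nat (Suc (nat k)) * (of_int (n + 1) gchoose Suc (nat k)) * fact (nat k)"
      unfolding k by (simp add: mult_ac)
    also have "\<dots> = of_int (n + 1) * ?ff n k"
      by (subst gbinomial_absorption) simp
    finally show ?thesis by simp
  qed
  \<comment> \<open>For negative k, \<open>nat k\<close> carries no information, but then one of the
    exponents is negative and the product vanishes.\<close>
  have k0: "?E Y2 * ?E Y3 * ?E Y4 = 0" if "k < 0"
    using that by (auto simp: k_def exp_term_def)
  show ?thesis
  proof (cases "w = Y1")
    case True
    have "of_int (e Y1 + 1) * (fls_nth f (n + 1) * ?ff (n + 1) k) = fls_nth (fls_deriv f) n * ?ff n k"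
      if "k \<ge> 0"
    proof -
      have eq: "of_int (e Y1 + 1) = (of_int (n + 1) - of_nat (nat k) :: complex)"
        using that by (simp add: n_def k_def)
      have "of_int (e Y1 + 1) * (fls_nth f (n + 1) * ?ff (n + 1) k) = fls_nth f (n + 1) * fact (nat k)
          * ((of_int (n + 1) - of_nat (nat k)) * (of_int (n + 1) gchoose nat k))"
        unfolding eq by (simp only: mult_ac)
      also have "\<dots> = fls_nth (fls_deriv f) n * ?ff n k"
        unfolding gbinomial_absorb_comp by (simp add: mult_ac)
      finally show ?thesis .
    qed
    then have eq: "of_int (e Y1 + 1) * (fls_nth f (n + 1) * ?ff (n + 1) k) * (?E Y2 * ?E Y3 * ?E Y4)
        = fls_nth (fls_deriv f) n * ?ff n k * (?E Y2 * ?E Y3 * ?E Y4)"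
      using k0 by (cases "k \<ge> 0") auto
    have l1: "laur_lin_coef f c (e(Y1 := e Y1 + 1)) = fls_nth f (n + 1) * ?ff (n + 1) k
        * of_int (c Y1) powi (e Y1 + 1) * (?E Y2 * ?E Y3 * ?E Y4)"
      using assms(1) by (simp add: laur_lin_coef_eq n_def k_def add_ac)
    have l2: "laur_lin_coef (fls_deriv f) c e = fls_nth (fls_deriv f) n * ?ff n k
        * of_int (c Y1) powi e Y1 * (?E Y2 * ?E Y3 * ?E Y4)"
      unfolding laur_lin_coef_eq[of c, OF assms(1)] n_def k_def ..
    have "of_int (e Y1 + 1) * laur_lin_coef f c (e(Y1 := e Y1 + 1)) = of_int (c Y1) powi (e Y1 + 1)
        * (of_int (e Y1 + 1) * (fls_nth f (n + 1) * ?ff (n + 1) k) * (?E Y2 * ?E Y3 * ?E Y4))"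
      unfolding l1 by (simp only: mult_ac)
    also have "\<dots> = of_int (c Y1) * laur_lin_coef (fls_deriv f) c e"
      unfolding eq l2 using assms(1) by (simp add: power_int_add_1 mult_ac)
    finally show ?thesis using True by simp
  next
    case False
    with assms(2) have w: "w \<in> {Y2, Y3, Y4}" by (auto simp: Ys_def)
    define O' where "O' = (\<Prod>u\<in>{Y2, Y3, Y4} - {w}. ?E u)"
    have split: "?E Y2 * ?E Y3 * ?E Y4 = ?E w * O'"
      using w by (auto simp: O'_def insert_Diff_if)
    have l1: "laur_lin_coef f c (e(w := e w + 1)) = fls_nth f (n + 1) * ?ff (n + 1) (k + 1)
        * of_int (c Y1) powi e Y1 * (exp_term (of_int (c w)) (e w + 1) * O')"
      using w assms(1)
      by (auto simp: laur_lin_coef_eq n_def k_def O'_def insert_Diff_if add_ac mult_ac)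
    have l2: "laur_lin_coef (fls_deriv f) c e = fls_nth (fls_deriv f) n * ?ff n k
        * of_int (c Y1) powi e Y1 * (?E w * O')"
      unfolding laur_lin_coef_eq[of c, OF assms(1)] split n_def k_def ..
    have "of_int (e w + 1) * laur_lin_coef f c (e(w := e w + 1)) =
        (fls_nth f (n + 1) * ?ff (n + 1) (k + 1)) * of_int (c Y1) powi e Y1
        * ((of_int (e w + 1) * exp_term (of_int (c w)) (e w + 1)) * O')"
      unfolding l1 by (simp only: mult_ac)
    also have "\<dots> = (fls_nth f (n + 1) * ?ff (n + 1) (k + 1)) * of_int (c Y1) powi e Y1
        * (of_int (c w) * (?E w * O'))"
      unfolding exp_term_Suc by (simp only: mult_ac)
    also have "\<dots> = (fls_nth (fls_deriv f) n * ?ff n k) * of_int (c Y1) powi e Y1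
        * (of_int (c w) * (?E w * O'))"
      using R k0 unfolding split by (cases "k \<ge> 0") auto
    also have "\<dots> = of_int (c w) * laur_lin_coef (fls_deriv f) c e"
      unfolding l2 by (simp only: mult_ac)
    finally show ?thesis .
  qed
qed

text \<open>Coefficient of a product with \<open>exp (\<Sum>w. d w y\<^sub>w)\<close>; the first factor contributes
  \<open>x\<^sub>2\<close> only to the power \<open>x\<close>, and no power of \<open>x\<^sub>1\<close>.\<close>
definition conv :: "int \<Rightarrow> ((var \<Rightarrow> int) \<Rightarrow> complex) \<Rightarrow> (var \<Rightarrow> complex) \<Rightarrow> (var \<Rightarrow> int) \<Rightarrow> complex" where
  "conv x L d e = Sum_any (\<lambda>g. if g X1 = 0 \<and> g X2 = x then L g * expcoef d (\<lambda>w. e w - g w) else 0)"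

text \<open>A class of series whose product with a power series in the y's has finite coefficient
  sums: only the leading variable \<open>Y1\<close> may have negative exponents, and the total
  degree is bounded below.\<close>

definition laurent_supp :: "int \<Rightarrow> ((var \<Rightarrow> int) \<Rightarrow> complex) \<Rightarrow> bool" where
  "laurent_supp M L \<longleftrightarrow>
     (\<forall>g. L g \<noteq> 0 \<longrightarrow> 0 \<le> g Y2 \<and> 0 \<le> g Y3 \<and> 0 \<le> g Y4 \<and> M \<le> g Y1 + g Y2 + g Y3 + g Y4)"

lemma laurent_supp_expcoef: "laurent_supp 0 (expcoef c)"
  by (auto simp: laurent_supp_def expcoef_def Ys_def split: if_splits)

lemma laurent_supp_laur_lin_coef:
  assumes "c Y1 \<noteq> 0"
  shows "laurent_supp (fls_subdegree f) (laur_lin_coef f c)"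
  unfolding laurent_supp_def
proof (intro allI impI)
  fix g
  assume "laur_lin_coef f c g \<noteq> 0"
  then have nz: "fls_nth f (g Y1 + g Y2 + g Y3 + g Y4) \<noteq> 0" "exp_term (of_int (c Y2)) (g Y2) \<noteq> 0"
    "exp_term (of_int (c Y3)) (g Y3) \<noteq> 0" "exp_term (of_int (c Y4)) (g Y4) \<noteq> 0"
    unfolding laur_lin_coef_eq[of c, OF assms] by auto
  have "fls_subdegree f \<le> g Y1 + g Y2 + g Y3 + g Y4"
    using nz(1) fls_eq0_below_subdegree not_le by blast
  moreover have "0 \<le> n" if "exp_term a n \<noteq> 0" for a n
    using that exp_term_simps(2) not_le by blast
  ultimately show "0 \<le> g Y2 \<and> 0 \<le> g Y3 \<and> 0 \<le> g Y4 \<and> fls_subdegree f \<le> g Y1 + g Y2 + g Y3 + g Y4"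
    using nz(2-4) by blast
qed

text \<open>The exponential factor bounds every y-exponent of g by that of e. The lower bound on the
  total degree then bounds the exponent of \<open>Y1\<close> from below.\<close>

lemma conv_support_bound:
  assumes "laurent_supp M L" "L g \<noteq> 0" "expcoef d (\<lambda>w. e w - g w) \<noteq> 0" "g X1 = 0"
    and "K \<ge> \<bar>g X2\<bar> + \<bar>M\<bar> + \<bar>e Y1\<bar> + \<bar>e Y2\<bar> + \<bar>e Y3\<bar> + \<bar>e Y4\<bar>"
  shows "g \<in> {g. \<forall>w. g w \<in> {-K..K}}"
proof -
  have "g w \<le> e w" if "w \<in> Ys" for w
    using expcoef_diff_le[OF assms(3) that] .
  then have "g Y1 \<le> e Y1" "g Y2 \<le> e Y2" "g Y3 \<le> e Y3" "g Y4 \<le> e Y4"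
    by (auto simp: Ys_def)
  moreover have "0 \<le> g Y2" "0 \<le> g Y3" "0 \<le> g Y4" "M \<le> g Y1 + g Y2 + g Y3 + g Y4"
    using assms(1,2) by (auto simp: laurent_supp_def)
  ultimately show ?thesis using assms(4,5) by (auto simp: all_var)
qed

lemma finite_conv_support:
  assumes "laurent_supp M L"
  shows "finite {g. g X1 = 0 \<and> g X2 = x \<and> L g \<noteq> 0 \<and> expcoef d (\<lambda>w. e w - g w) \<noteq> 0}"
  by (rule finite_subset[OF subsetI finite_bounded_exponents],
      rule conv_support_bound[OF assms,
        where K = "\<bar>x\<bar> + \<bar>M\<bar> + \<bar>e Y1\<bar> + \<bar>e Y2\<bar> + \<bar>e Y3\<bar> + \<bar>e Y4\<bar>"])
    auto

lemma conv_eq_sum: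
  assumes "laurent_supp M L" "K \<ge> \<bar>x\<bar> + \<bar>M\<bar> + \<bar>e Y1\<bar> + \<bar>e Y2\<bar> + \<bar>e Y3\<bar> + \<bar>e Y4\<bar>"
  shows "conv x L d e = (\<Sum>g\<in>{g. \<forall>w. g w \<in> {-K..K}}.
    if g X1 = 0 \<and> g X2 = x then L g * expcoef d (\<lambda>w. e w - g w) else 0)"
  unfolding conv_def
proof (rule Sum_any.expand_superset[OF finite_bounded_exponents], rule subsetI)
  fix g assume "g \<in> {g. (if g X1 = 0 \<and> g X2 = x then L g * expcoef d (\<lambda>w. e w - g w) else 0) \<noteq> 0}"
  then have "g X1 = 0" "g X2 = x" "L g \<noteq> 0" "expcoef d (\<lambda>w. e w - g w) \<noteq> 0"
    by (auto split: if_splits)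
  then show "g \<in> {g. \<forall>w. g w \<in> {-K..K}}"
    using assms(2) by (intro conv_support_bound[OF assms(1)]) auto
qed

lemma conv_cmult:
  assumes "laurent_supp M L"
  shows "conv x (\<lambda>g. a * L g) d e = a * conv x L d e"
proof -
  have "finite {g. (if g X1 = 0 \<and> g X2 = x then L g * expcoef d (\<lambda>w. e w - g w) else 0) \<noteq> 0}"
    by (rule finite_subset[OF _ finite_conv_support[OF assms, of x d e]]) auto
  then show ?thesis
    unfolding conv_def by (subst Sum_any_right_distrib) (auto intro!: Sum_any.cong)
qed

lemma conv_add:
  assumes "laurent_supp M L" "laurent_supp M' L'"
  shows "conv x (\<lambda>g. L g + L' g) d e = conv x L d e + conv x L' d e"
proof -
  have *: "finite {g. (if g X1 = 0 \<and> g X2 = x then L g * expcoef d (\<lambda>w. e w - g w) else 0) \<noteq> 0}"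
    if "laurent_supp M L" for L M
    by (rule finite_subset[OF _ finite_conv_support[OF that, of x d e]]) auto
  then show ?thesis
    unfolding conv_def 
    by (subst Sum_any.distrib[symmetric]) (use * assms in \<open>auto intro!: Sum_any.cong simp: algebra_simps\<close>)
qed

lemma conv_deriv:
  assumes "laurent_supp M L" "w \<in> Ys"
  shows "of_int (e w + 1) * conv x L d (e(w := e w + 1)) =
     conv x (\<lambda>g. of_int (g w + 1) * L (g(w := g w + 1))) d e + d w * conv x L d e"
proof -
  let ?e = "e(w := e w + 1)"
  \<comment> \<open>Product rule: write e w + 1 as g w plus e w + 1 - g w. The first part
    differentiates L, the second the exponential.\<close>
  let ?F = "\<lambda>g. if g X1 = 0 \<and> g X2 = x then of_int (g w) * L g * expcoef d (\<lambda>w. ?e w - g w) else 0"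
  let ?G = "\<lambda>g. if g X1 = 0 \<and> g X2 = x then L g * (d w * expcoef d (\<lambda>w. e w - g w)) else 0"
  have E: "of_int (e w + 1 - g w) * expcoef d (\<lambda>w. ?e w - g w) = d w * expcoef d (\<lambda>w. e w - g w)" for g
  proof -
    have "(\<lambda>w. ?e w - g w) = (\<lambda>w. e w - g w)(w := (e w - g w) + 1)" by auto
    then show ?thesis using expcoef_deriv[OF assms(2), of "\<lambda>w. e w - g w" d] by (simp add: algebra_simps)
  qed
  have fin: "finite {g. (if g X1 = 0 \<and> g X2 = x then L g * expcoef d (\<lambda>w. e w - g w) else 0) \<noteq> 0}" for e
    by (rule finite_subset[OF _ finite_conv_support[OF assms(1), of x d e]]) auto
  have finF: "finite {g. ?F g \<noteq> 0}"
    by (rule finite_subset[OF _ fin[of ?e]]) auto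
  have finG: "finite {g. ?G g \<noteq> 0}"
    by (rule finite_subset[OF _ fin[of e]]) auto
  have "of_int (e w + 1) * conv x L d ?e = Sum_any (\<lambda>g. ?F g + ?G g)"
    unfolding conv_def Sum_any_right_distrib[OF fin] E[symmetric]
    by (rule Sum_any.cong) (simp add: algebra_simps)
  also have "\<dots> = Sum_any ?F + Sum_any ?G"
    by (rule Sum_any.distrib[OF finF finG])
  also have "Sum_any ?G = d w * conv x L d e"
    unfolding conv_def Sum_any_right_distrib[OF fin] by (rule Sum_any.cong) simp
  also have "Sum_any ?F = conv x (\<lambda>g. of_int (g w + 1) * L (g(w := g w + 1))) d e"
    unfolding conv_def
  proof (rule Sum_any.reindex_cong)
    show "bij (\<lambda>g :: var \<Rightarrow> int. g(w := g w + 1))"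
      by (rule bij_betw_byWitness[of _ "\<lambda>g. g(w := g w - 1)"]) auto
    have "(\<lambda>wa. ?e wa - (g(w := g w + 1)) wa) = (\<lambda>wa. e wa - g wa)" for g by auto
    then show "?F \<circ> (\<lambda>g. g(w := g w + 1)) = (\<lambda>g. if g X1 = 0 \<and> g X2 = x
        then of_int (g w + 1) * L (g(w := g w + 1)) * expcoef d (\<lambda>w. e w - g w) else 0)"
      using assms(2) by (auto simp: Ys_def fun_eq_iff)
  qed
  finally show ?thesis .
qed

lemma conv_eq_0:
  assumes "laurent_supp M L" "w \<in> {Y2, Y3, Y4}" "e w < 0"
  shows "conv x L d e = 0"
proof -
  have "L g * expcoef d (\<lambda>w. e w - g w) = 0" for g
  proof (cases "L g = 0")
    case False
    then have "e w - g w < 0" using assms by (auto simp: laurent_supp_def)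
    then show ?thesis using expcoef_eq_0[of w "\<lambda>w. e w - g w" d] assms(2) by (auto simp: Ys_def)
  qed simp
  then show ?thesis unfolding conv_def by (simp only: if_cancel Sum_any.neutral)
qed

text \<open>Both sides satisfy the same first-order equation in every y, with factor c w + d w.
  Induction on the total degree thus replaces a multinomial identity; the parameter x only fixes
  which power of the second x-variable the first factor carries.\<close>

lemma conv_expcoef: "conv x (expcoef c) d e = expcoef (\<lambda>w. c w + d w) e"
proof (cases "\<exists>w\<in>Ys. e w < 0")
  case True
  then obtain w where w: "w \<in> Ys" "e w < 0" by blast
  have "expcoef c g * expcoef d (\<lambda>w. e w - g w) = 0" for g
    using expcoef_eq_0[OF w(1), of g c] expcoef_eq_0[OF w(1), of "\<lambda>w. e w - g w" d] w(2)
    by (cases "g w < 0") auto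
  then show ?thesis
    unfolding conv_def using expcoef_eq_0[of w e, OF w]
    by (simp only: if_cancel Sum_any.neutral)
next
  case False
  define N where "N = nat (\<Sum>w\<in>Ys. e w)"
  from False have "\<forall>w\<in>Ys. e w \<ge> 0" by force
  with N_def show ?thesis
  proof (induction N arbitrary: e)
    case 0
    then have e: "e w = 0" if "w \<in> Ys" for w
      using that by (auto simp: Ys_def)
    define g0 :: "var \<Rightarrow> int" where "g0 = (\<lambda>w. if w = X2 then x else 0)"
    have "(if g X1 = 0 \<and> g X2 = x then expcoef c g * expcoef d (\<lambda>w. e w - g w) else 0)
        = (if g = g0 then 1 else 0)" for g
    proof (cases "\<forall>w\<in>Ys. g w = 0")
      case True
      then show ?thesis using e by (auto simp: expcoef_eq g0_def var_fun_eq_iff Ys_def)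
    next
      case False
      then obtain w where w: "w \<in> Ys" "g w \<noteq> 0" by blast
      have "expcoef c g * expcoef d (\<lambda>w. e w - g w) = 0"
        using expcoef_eq_0[OF w(1), of g c] expcoef_eq_0[OF w(1), of "\<lambda>w. e w - g w" d] w e
        by (cases "g w < 0") auto
      moreover have "g \<noteq> g0" using w by (auto simp: g0_def Ys_def)
      ultimately show ?thesis by simp
    qed
    then have "conv x (expcoef c) d e = 1" by (simp add: conv_def)
    moreover have "expcoef (\<lambda>w. c w + d w) e = 1" using e by (simp add: expcoef_eq Ys_def)
    ultimately show ?case by simp
  next
    case (Suc N)
    obtain w where w: "w \<in> Ys" "e w > 0"
    proof (rule ccontr)
      assume "\<not> thesis"
      with that Suc.prems have "\<forall>w\<in>Ys. e w = 0" by force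
      with Suc.prems show False by simp
    qed
    define e' where "e' = e(w := e w - 1)"
    have e: "e = e'(w := e' w + 1)" "e' w = e w - 1" by (auto simp: e'_def)
    have "(\<Sum>u\<in>Ys. e u) = (\<Sum>u\<in>Ys. e' u + (if u = w then 1 else 0))"
      by (intro sum.cong) (auto simp: e'_def)
    also have "\<dots> = (\<Sum>u\<in>Ys. e' u) + 1"
      using w by (simp add: sum.distrib Ys_def)
    finally have "N = nat (\<Sum>u\<in>Ys. e' u)" using Suc.prems by linarith
    moreover have "\<forall>u\<in>Ys. e' u \<ge> 0" using Suc.prems w by (auto simp: e'_def)
    ultimately have IH: "conv x (expcoef c) d e' = expcoef (\<lambda>w. c w + d w) e'"
      by (rule Suc.IH)
    have "of_int (e' w + 1) * conv x (expcoef c) d e = (c w + d w) * conv x (expcoef c) d e'"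
      unfolding e(1) conv_deriv[OF laurent_supp_expcoef w(1)] expcoef_deriv[OF w(1)]
        conv_cmult[OF laurent_supp_expcoef] by (simp add: algebra_simps)
    also have "\<dots> = of_int (e' w + 1) * expcoef (\<lambda>w. c w + d w) e"
      unfolding e(1) expcoef_deriv[OF w(1)] IH ..
    finally show ?case using w e(2) by simp
  qed
qed

section \<open>Moving exponentials between the two factors of a product\<close>

abbreviation fls_exp :: "complex \<Rightarrow> complex fls" where
  "fls_exp s \<equiv> fps_to_fls (fps_exp s)"

lemma fls_exp_nth: "fls_nth (fls_exp s) n = exp_term s n"
  by (auto simp: exp_term_def)

lemma conv_laur_lin_coef_base:
  assumes c: "c Y1 = 1" and e: "e Y2 = 0" "e Y3 = 0" "e Y4 = 0"
  shows "conv x (laur_lin_coef f c) d e = fls_nth (f * fls_exp (d Y1)) (e Y1)"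
proof -
  let ?F = "\<lambda>g. if g X1 = 0 \<and> g X2 = x then laur_lin_coef f c g * expcoef d (\<lambda>w. e w - g w) else 0"
  define h :: "int \<Rightarrow> var \<Rightarrow> int" where "h a = (\<lambda>_. 0)(X2 := x, Y1 := a)" for a
  let ?A = "{fls_subdegree f..e Y1}"
  have "c Y1 \<noteq> 0" using c by simp
  have supp: "g \<in> h ` ?A" if "?F g \<noteq> 0" for g
  proof
    from that have nz: "g X1 = 0" "g X2 = x" "laur_lin_coef f c g \<noteq> 0"
      "expcoef d (\<lambda>w. e w - g w) \<noteq> 0"
      by (auto split: if_splits)
    have le: "g w \<le> e w" if "w \<in> Ys" for w
      using expcoef_diff_le[OF nz(4) that] .
    have "0 \<le> g Y2 \<and> 0 \<le> g Y3 \<and> 0 \<le> g Y4 \<and> fls_subdegree f \<le> g Y1 + g Y2 + g Y3 + g Y4"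
      using laurent_supp_laur_lin_coef[of c f, OF \<open>c Y1 \<noteq> 0\<close>] nz(3) by (auto simp: laurent_supp_def)
    moreover have "g Y1 \<le> e Y1" "g Y2 \<le> 0" "g Y3 \<le> 0" "g Y4 \<le> 0"
      using le[of Y1] le[of Y2] le[of Y3] le[of Y4] e by (auto simp: Ys_def)
    ultimately show "g Y1 \<in> ?A" "g = h (g Y1)"
      using nz(1,2) by (auto simp: h_def var_fun_eq_iff)
  qed
  have "conv x (laur_lin_coef f c) d e = sum ?F (h ` ?A)"
    unfolding conv_def by (rule Sum_any.expand_superset) (use supp in blast)+
  also have "\<dots> = (\<Sum>a\<in>?A. ?F (h a))"
    by (subst sum.reindex) (auto simp: inj_on_def h_def var_fun_eq_iff)
  also have "\<dots> = (\<Sum>a\<in>?A. fls_nth f a * exp_term (d Y1) (e Y1 - a))"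
    by (intro sum.cong refl)
      (use c e in \<open>simp add: laur_lin_coef_eq expcoef_eq h_def\<close>)
  also have "\<dots> = fls_nth (f * fls_exp (d Y1)) (e Y1)"
    by (simp add: fls_times_nth(2) fls_exp_nth[symmetric] fls_subdegree_fls_to_fps)
  finally show ?thesis .
qed

lemma laur_lin_coef_add:
  assumes "c Y1 \<noteq> 0"
  shows "laur_lin_coef (f + g) c e = laur_lin_coef f c e + laur_lin_coef g c e"
  by (simp add: laur_lin_coef_eq[of c, OF assms] algebra_simps)

lemma laur_lin_coef_cmult:
  assumes "c Y1 \<noteq> 0"
  shows "laur_lin_coef (fls_const a * f) c e = a * laur_lin_coef f c e"
  by (simp add: laur_lin_coef_eq[of c, OF assms])

lemma conv_laur_add:
  assumes "c Y1 \<noteq> 0"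
  shows "conv x (laur_lin_coef (f + g) c) d e = conv x (laur_lin_coef f c) d e + conv x (laur_lin_coef g c) d e"
  unfolding laur_lin_coef_add[of c, OF assms, abs_def]
  by (rule conv_add) (rule laurent_supp_laur_lin_coef[of c, OF assms])+

lemma conv_laur_cmult:
  assumes "c Y1 \<noteq> 0"
  shows "conv x (laur_lin_coef (fls_const a * f) c) d e = a * conv x (laur_lin_coef f c) d e"
  unfolding laur_lin_coef_cmult[of c, OF assms, abs_def]
  by (rule conv_cmult) (rule laurent_supp_laur_lin_coef[of c, OF assms])

lemma conv_laur_diff:
  assumes "c Y1 \<noteq> 0"
  shows "conv x (laur_lin_coef (f - g) c) d e = conv x (laur_lin_coef f c) d e - conv x (laur_lin_coef g c) d e"
  using conv_laur_add[of c x "f - g" g d e] assms by simp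

lemma conv_laur_deriv:
  assumes "c Y1 \<noteq> 0" "w \<in> Ys"
  shows "of_int (e w + 1) * conv x (laur_lin_coef f c) d (e(w := e w + 1)) =
    of_int (c w) * conv x (laur_lin_coef (fls_deriv f) c) d e + d w * conv x (laur_lin_coef f c) d e"
  unfolding conv_deriv[OF laurent_supp_laur_lin_coef[of c, OF assms(1)] assms(2)]
    laur_lin_coef_deriv[of c, OF assms]
    conv_cmult[OF laurent_supp_laur_lin_coef[of c, OF assms(1)]] ..

lemma fls_deriv_exp: "fls_deriv (fls_exp s) = fls_const s * fls_exp s"
  by (simp add: fls_deriv_fps_to_fls fps_exp_deriv fls_times_fps_to_fls)

lemma fls_exp_add: "fls_exp (a + b) = fls_exp a * fls_exp b"
  by (simp add: fps_exp_add_mult fls_times_fps_to_fls)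

text \<open>Both sides satisfy the same first-order equations in \<open>y\<^sub>2, y\<^sub>3, y\<^sub>4\<close>, so it
  suffices to compare them at \<open>y\<^sub>2 = y\<^sub>3 = y\<^sub>4 = 0\<close>, where they are products of Laurent series
  in \<open>y\<^sub>1\<close>.\<close>
lemma conv_laur_exp_shift:
  assumes c: "c Y1 = 1"
  shows "conv x (laur_lin_coef f c) d e =
    conv x (laur_lin_coef (f * fls_exp s) c) (\<lambda>w. d w - s * of_int (c w)) e"
proof -
  have c0: "c Y1 \<noteq> 0" using c by simp
  note supp = laurent_supp_laur_lin_coef[of c, OF c0]
  let ?d = "\<lambda>w. d w - s * of_int (c w)"
  define N where "N = nat (e Y2 + e Y3 + e Y4)"
  show ?thesis
  proof (cases "e Y2 \<ge> 0 \<and> e Y3 \<ge> 0 \<and> e Y4 \<ge> 0")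
    case False
    then obtain w where w: "w \<in> {Y2, Y3, Y4}" "e w < 0" by force
    show ?thesis by (simp only: conv_eq_0[where w = w and e = e, OF supp w])
  next
    case True
    with N_def show ?thesis
    \<comment> \<open>The series f is generalized because differentiating in y_w brings in its
      derivative.\<close>
    proof (induction N arbitrary: e f)
      case 0
      then have e: "e Y2 = 0" "e Y3 = 0" "e Y4 = 0" by auto
      have "fls_exp (d Y1) = fls_exp s * fls_exp (d Y1 - s)"
        unfolding fls_exp_add[symmetric] by simp
      then show ?case
        unfolding conv_laur_lin_coef_base[of c, OF c e] using c by (simp add: mult.assoc)
    next
      case (Suc N)
      obtain w where w: "w \<in> {Y2, Y3, Y4}" "e w > 0"
        using Suc.prems by (cases "e Y2 > 0"; cases "e Y3 > 0"; cases "e Y4 > 0") auto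
      then have wY: "w \<in> Ys" by (auto simp: Ys_def)
      define e' where "e' = e(w := e w - 1)"
      have e: "e = e'(w := e' w + 1)" "e' w = e w - 1" by (auto simp: e'_def)
      have e': "N = nat (e' Y2 + e' Y3 + e' Y4)" "e' Y2 \<ge> 0 \<and> e' Y3 \<ge> 0 \<and> e' Y4 \<ge> 0"
        using Suc.prems w by (auto simp: e'_def)
      have "of_int (e' w + 1) * conv x (laur_lin_coef f c) d e =
          of_int (c w) * conv x (laur_lin_coef (fls_deriv f) c) d e' + d w * conv x (laur_lin_coef f c) d e'"
        unfolding e(1) by (rule conv_laur_deriv[of c, OF c0 wY])
      also have "\<dots> = of_int (c w) * conv x (laur_lin_coef (fls_deriv f * fls_exp s) c) ?d e'
          + d w * conv x (laur_lin_coef (f * fls_exp s) c) ?d e'"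
        using Suc.IH[OF e', of f] Suc.IH[OF e', of "fls_deriv f"] by simp
      also have "\<dots> = of_int (c w) * conv x (laur_lin_coef (fls_deriv (f * fls_exp s)) c) ?d e'
          + ?d w * conv x (laur_lin_coef (f * fls_exp s) c) ?d e'"
      proof -
        \<comment> \<open>The extra term s f e^{su} from the product rule, times c w, cancels the
          shift -s c w in the exponent.\<close>
        have D: "fls_deriv (f * fls_exp s) = fls_const s * (f * fls_exp s) + fls_deriv f * fls_exp s"
          by (simp add: fls_deriv_exp mult_ac)
        show ?thesis
          unfolding D conv_laur_add[of c, OF c0] conv_laur_cmult[of c, OF c0]
          by (simp add: algebra_simps)
      qed
      also have "\<dots> = of_int (e' w + 1) * conv x (laur_lin_coef (f * fls_exp s) c) ?d e"
        unfolding e(1) by (rule conv_laur_deriv[of c, OF c0 wY, symmetric])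
      finally show ?case using w e(2) by simp
    qed
  qed
qed

text \<open>Negating the form multiplies the coefficient by -1 to the total degree, and evenness of
  f leaves only even degrees. Both forms have \<open>Y1\<close> as leading variable, so they are
  expanded in the same direction.\<close>

lemma laur_lin_coef_even:
  assumes "c Y1 \<noteq> 0" "\<And>n. odd n \<Longrightarrow> fls_nth f n = 0"
  shows "laur_lin_coef f (\<lambda>w. - c w) e = laur_lin_coef f c e"
proof -
  let ?n = "e Y1 + e Y2 + e Y3 + e Y4"
  have neg: "exp_term (- a) n = (-1) powi n * exp_term a n" for a n
    by (auto simp: exp_term_def power_int_def power_minus[of a])
  show ?thesis
  proof (cases "odd ?n")
    case True
    have "(\<lambda>w. - c w) Y1 \<noteq> 0" using assms(1) by simp
    then show ?thesis using assms(1) assms(2)[OF True] by (simp add: laur_lin_coef_eq)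
  next
    case False
    then have "(-1 :: complex) powi ?n = 1" by (simp add: power_int_minus_left)
    then have s: "(-1 :: complex) powi e Y1 * ((-1) powi e Y2 * ((-1) powi e Y3 * (-1) powi e Y4)) = 1"
      by (simp add: power_int_add mult.assoc)
    have c1: "(- of_int (c Y1) :: complex) powi e Y1 = (-1) powi e Y1 * of_int (c Y1) powi e Y1"
      by (metis mult_minus1 power_int_mult_distrib)
    have "laur_lin_coef f (\<lambda>w. - c w) e =
      ((-1) powi e Y1 * ((-1) powi e Y2 * ((-1) powi e Y3 * (-1) powi e Y4))) * laur_lin_coef f c e"
      using assms(1) by (simp add: laur_lin_coef_eq neg c1 mult_ac)
    then show ?thesis unfolding s by simp
  qed
qed

lemma laur_lin_coef_one:
  assumes "c Y1 = 1"
  shows "laur_lin_coef 1 c = expcoef (\<lambda>_. 0)"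
proof
  fix e
  show "laur_lin_coef 1 c e = expcoef (\<lambda>_. 0) e"
  proof (cases "e Y2 \<ge> 0 \<and> e Y3 \<ge> 0 \<and> e Y4 \<ge> 0")
    case False
    then show ?thesis
      using assms by (auto simp: laur_lin_coef_eq expcoef_eq not_le)
  next
    case True
    have "(0 :: complex) gchoose nat k = 0" if "k > 0" for k
    proof -
      from that obtain j where "nat k = Suc j" by (cases "nat k") auto
      then show ?thesis by simp
    qed
    moreover have "e Y2 = 0 \<and> e Y3 = 0 \<and> e Y4 = 0" if "\<not> e Y2 + e Y3 + e Y4 > 0"
      using that True by linarith
    ultimately show ?thesis
      using assms
      by (cases "e Y1 + e Y2 + e Y3 + e Y4 = 0"; cases "e Y2 + e Y3 + e Y4 > 0")
        (auto simp: laur_lin_coef_eq expcoef_eq exp_term_zero)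
  qed
qed

text \<open>This is the shift lemma for f = 1: the factor e^{su} is absorbed into the exponent, and
  the constant series left over acts as the exponential of 0.\<close>

lemma conv_laur_exp:
  assumes "c Y1 = 1"
  shows "conv x (laur_lin_coef (fls_exp s) c) d e = expcoef (\<lambda>w. d w + s * of_int (c w)) e"
  using conv_laur_exp_shift[of c x 1 "\<lambda>w. d w + s * of_int (c w)" e s] assms
  by (simp add: laur_lin_coef_one conv_expcoef)

lemma conv_laur_exp_sum:
  assumes "c Y1 = 1" "finite A"
  shows "conv x (laur_lin_coef (\<Sum>i\<in>A. fls_const (a i) * fls_exp (s i)) c) d e =
    (\<Sum>i\<in>A. a i * expcoef (\<lambda>w. d w + s i * of_int (c w)) e)"
  using assms(2)
proof induction
  case empty
  have "laur_lin_coef 0 c = (\<lambda>_. 0)" using assms(1) by (auto simp: laur_lin_coef_eq)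
  then show ?case
    unfolding conv_def by (simp only: sum.empty mult_zero_left if_cancel Sum_any.neutral)
next
  case (insert i A)
  then show ?case
    using assms(1) by (simp add: conv_laur_add conv_laur_cmult conv_laur_exp)
qed

section \<open>The central terms\<close>

text \<open>The division defining \<open>Fser\<close> is exact, since 1 - e^{-u} has order one and
  therefore divides u.\<close>

lemma Fser_mult: "Fser * (1 - fps_exp (-1)) = fps_X"
proof -
  have "subdegree (1 - fps_exp (-1) :: complex fps) = 1"
    by (rule subdegreeI) auto
  moreover from this have "(1 - fps_exp (-1) :: complex fps) \<noteq> 0"
    by auto
  ultimately have "(1 - fps_exp (-1) :: complex fps) dvd fps_X"
    by (subst fps_dvd_iff) auto
  then show ?thesis by (simp add: Fser_def)
qed

lemma Hser_mult: "Hser * (1 - fls_exp (-1)) = 1"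
proof -
  have "Hser * (1 - fls_exp (-1)) = fls_X_inv * fps_to_fls (Fser * (1 - fps_exp (-1)))"
    by (simp add: Hser_def fls_times_fps_to_fls mult.assoc)
  also have "\<dots> = 1"
    unfolding Fser_mult by (simp add: fls_X_inv_times_conv_shift fls_X_conv_shift_1)
  finally show ?thesis .
qed

text \<open>With G(u) = F(-u) one has G e^u = F, hence F - G = F (1 - e^{-u}) = u. So the only odd
  coefficient is the linear one; this is the vanishing of the odd Bernoulli numbers.\<close>

lemma Fser_nth_odd:
  assumes "odd k" "k \<noteq> 1"
  shows "fps_nth Fser k = 0"
proof -
  define G where "G = fps_compose Fser (- fps_X)"
  have "G * (1 - fps_exp 1) = - fps_X"
    using arg_cong[OF Fser_mult, of "\<lambda>f. fps_compose f (- fps_X)"]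
    by (simp add: G_def fps_compose_mult_distrib fps_compose_sub_distrib)
  moreover have "fps_exp 1 * fps_exp (-1) = (1 :: complex fps)"
    by (simp add: fps_exp_add_mult[symmetric])
  ultimately have "(G * fps_exp 1) * (1 - fps_exp (-1)) = Fser * (1 - fps_exp (-1))"
    unfolding Fser_mult by (simp add: algebra_simps)
  moreover have "(1 - fps_exp (-1) :: complex fps) \<noteq> 0"
    using Fser_mult by force
  ultimately have "G * fps_exp 1 = Fser" by (metis mult_right_cancel)
  then have "Fser - G = Fser * (1 - fps_exp (-1))"
    using \<open>fps_exp 1 * fps_exp (-1) = 1\<close> by (simp add: algebra_simps) (metis mult.assoc mult.commute mult.right_neutral)
  then have "fps_nth (Fser - G) k = fps_nth fps_X k" unfolding Fser_mult by simp
  then show ?thesis using assms by (simp add: G_def fps_compose_uminus')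
qed

text \<open>The coefficient of u^n in H' is (n + 1) F_{n+2}. The exceptional odd coefficient F_1
  occurs at n = -1, where the factor n + 1 removes it.\<close>

lemma deriv_Hser_nth_odd:
  assumes "odd n"
  shows "fls_nth (fls_deriv Hser) n = 0"
proof (cases "n = -1 \<or> n < -2")
  case True
  then show ?thesis by (auto simp: Hser_def fls_X_inv_times_conv_shift)
next
  case False
  then have "nat (n + 2) \<noteq> 1" "odd (nat (n + 2))" using assms by (auto simp: even_nat_iff)
  then have "fps_nth Fser (nat (n + 2)) = 0" using Fser_nth_odd by blast
  then show ?thesis by (auto simp: Hser_def fls_X_inv_times_conv_shift add.commute)
qed

text \<open>Both sides vanish at p = 0 and grow by e^{-pu} from p to p + 1, so two-sided induction
  covers negative p as well.\<close>

lemma geometric_Hser: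
  "(1 - fls_exp (- of_int p)) * Hser =
    (\<Sum>m\<in>{0..<p}. fls_exp (- of_int m)) - (\<Sum>m\<in>{p..<0}. fls_exp (- of_int m))"
proof -
  define L where "L p = (1 - fls_exp (- of_int p)) * Hser" for p :: int
  define S where "S p = (\<Sum>m\<in>{0..<p}. fls_exp (- of_int m)) - (\<Sum>m\<in>{p..<0}. fls_exp (- of_int m))" for p :: int
  have L: "L (p + 1) = L p + fls_exp (- of_int p)" for p
  proof -
    have "fls_exp (- of_int (p + 1)) = fls_exp (- of_int p) * fls_exp (-1)"
      unfolding fls_exp_add[symmetric] by simp
    then have "L (p + 1) = L p + fls_exp (- of_int p) * (Hser * (1 - fls_exp (-1)))"
      by (simp add: L_def algebra_simps)
    then show ?thesis unfolding Hser_mult by simp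
  qed
  have S: "S (p + 1) = S p + fls_exp (- of_int p)" for p
  proof (cases "p \<ge> 0")
    case True
    then have "{0..<p + 1} = insert p {0..<p}" by auto
    then show ?thesis using True by (simp add: S_def)
  next
    case False
    then have "{p..<0} = insert p {p + 1..<0}" by auto
    then show ?thesis using False by (simp add: S_def)
  qed
  have "L p = S p"
  proof (induction p rule: int_induct[of _ 0])
    case base
    then show ?case by (simp add: L_def S_def)
  next
    case (step1 i)
    then show ?case by (simp add: L S)
  next
    case (step2 i)
    then show ?case using L[of "i - 1"] S[of "i - 1"] by simp
  qed
  then show ?thesis by (simp add: L_def S_def)
qed

text \<open>Apply \<open>- D (D + p)\<close> to both sides of the geometric sum; it multiplies \<open>e\<^bsup>-mu\<^esup>\<close> by \<open>m (p - m)\<close>.\<close>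
lemma Hser_central_identity:
  fixes p :: int
  defines "H1 \<equiv> fls_deriv Hser"
  shows "(fls_deriv H1 - of_int p * H1) * fls_exp (- of_int p) - fls_deriv H1 - of_int p * H1 =
      (\<Sum>m\<in>{0..<p}. fls_const (of_int (m * (p - m))) * fls_exp (- of_int m))
    - (\<Sum>m\<in>{p..<0}. fls_const (of_int (m * (p - m))) * fls_exp (- of_int m))"
proof -
  define T where "T f = - (fls_deriv (fls_deriv f) + of_int p * fls_deriv f)" for f :: "complex fls"
  have dE: "fls_deriv (fls_exp (- of_int m)) = - (of_int m * fls_exp (- of_int m))" for m
    by (simp add: fls_deriv_exp fls_of_int)
  have TE: "T (fls_exp (- of_int m)) = fls_const (of_int (m * (p - m))) * fls_exp (- of_int m)" for m
  proof -
    have eq: "fls_const (of_int (m * (p - m))) = (of_int m * (of_int p - of_int m) :: complex fls)"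
      unfolding fls_of_int[symmetric] by simp
    show ?thesis
      unfolding eq T_def by (simp add: dE algebra_simps)
  qed
  have Tsum: "T (\<Sum>m\<in>A. fls_exp (- of_int m)) = (\<Sum>m\<in>A. T (fls_exp (- of_int m)))" for A :: "int set"
    by (simp add: T_def fls_deriv_sum sum_negf sum_subtractf sum_distrib_left)
  \<comment> \<open>D + p turns e^{-pu} H into e^{-pu} H', so that one further derivative gives
    e^{-pu} (H'' - p H').\<close>
  have "(fls_deriv H1 - of_int p * H1) * fls_exp (- of_int p) - fls_deriv H1 - of_int p * H1
      = T ((1 - fls_exp (- of_int p)) * Hser)"
    unfolding T_def by (simp add: dE H1_def algebra_simps)
  also have "\<dots> = T (\<Sum>m\<in>{0..<p}. fls_exp (- of_int m)) - T (\<Sum>m\<in>{p..<0}. fls_exp (- of_int m))"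
    unfolding geometric_Hser by (simp add: T_def algebra_simps)
  finally show ?thesis by (simp only: Tsum TE)
qed

text \<open>The derivative in y_1 acts on P alone and that in y_2 on Q alone. With u = P - Q, the
  relation e^{-pP} = e^{-pQ} e^{-pu} gives both terms the common exponential e^{-pQ}, and the
  one-variable \<open>Hser_central_identity\<close> applies to what remains.\<close>

lemma conv_central:
  fixes P Q :: "var \<Rightarrow> int" and p :: int
  assumes "P Y1 = 1" "Q Y1 = 0" "P Y2 = 0" "Q Y2 = 1"
  defines "L \<equiv> laur_lin_coef (fls_deriv Hser) (\<lambda>w. P w - Q w)"
  shows "of_int (e Y1 + 1) * conv x L (\<lambda>w. of_int (- p * P w)) (e(Y1 := e Y1 + 1))
       + of_int (e Y2 + 1) * conv x L (\<lambda>w. of_int (- p * Q w)) (e(Y2 := e Y2 + 1))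
       = central_sum p (\<lambda>m. expcoef (\<lambda>w. - of_int (m * P w + (p - m) * Q w)) e)"
proof -
  define c where "c = (\<lambda>w. P w - Q w)"
  have c: "c Y1 = 1" "c Y2 = -1" using assms by (auto simp: c_def)
  then have c0: "c Y1 \<noteq> 0" by simp
  let ?H1 = "fls_deriv Hser"
  let ?dP = "\<lambda>w. of_int (- p * P w) :: complex" and ?dQ = "\<lambda>w. of_int (- p * Q w) :: complex"
  let ?S = "\<lambda>f d. conv x (laur_lin_coef f c) d e"
  have "of_int (e Y1 + 1) * conv x L ?dP (e(Y1 := e Y1 + 1)) = ?S (fls_deriv ?H1) ?dP - of_int p * ?S ?H1 ?dP"
    unfolding L_def c_def[symmetric]
    by (subst conv_laur_deriv[of c, OF c0]) (use c assms in \<open>auto simp: Ys_def\<close>)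
  also have "\<dots> = ?S (fls_deriv ?H1 - of_int p * ?H1) ?dP"
    by (simp only: conv_laur_diff[of c, OF c0] fls_of_int conv_laur_cmult[of c, OF c0])
  also have "\<dots> = ?S ((fls_deriv ?H1 - of_int p * ?H1) * fls_exp (- of_int p)) ?dQ"
    by (subst conv_laur_exp_shift[of c, OF c(1), where s = "- of_int p"])
      (simp add: c_def algebra_simps)
  finally have 1: "of_int (e Y1 + 1) * conv x L ?dP (e(Y1 := e Y1 + 1)) = \<dots>" .
  have "of_int (e Y2 + 1) * conv x L ?dQ (e(Y2 := e Y2 + 1)) = - ?S (fls_deriv ?H1) ?dQ - of_int p * ?S ?H1 ?dQ"
    unfolding L_def c_def[symmetric]
    by (subst conv_laur_deriv[of c, OF c0]) (use c assms in \<open>auto simp: Ys_def\<close>)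
  then have 2: "of_int (e Y2 + 1) * conv x L ?dQ (e(Y2 := e Y2 + 1)) = - ?S (fls_deriv ?H1) ?dQ - ?S (of_int p * ?H1) ?dQ"
    by (simp only: fls_of_int conv_laur_cmult[of c, OF c0])
  have "?S ((fls_deriv ?H1 - of_int p * ?H1) * fls_exp (- of_int p)) ?dQ - ?S (fls_deriv ?H1) ?dQ - ?S (of_int p * ?H1) ?dQ
      = ?S ((\<Sum>m\<in>{0..<p}. fls_const (of_int (m * (p - m))) * fls_exp (- of_int m))
    - (\<Sum>m\<in>{p..<0}. fls_const (of_int (m * (p - m))) * fls_exp (- of_int m))) ?dQ"
    unfolding conv_laur_diff[of c, OF c0, symmetric] Hser_central_identity ..
  \<comment> \<open>Each e^{-mu} of the finite sum is absorbed into the exponent: -pQ - m (P - Q) =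
    -(mP + (p - m) Q).\<close>
  also have "\<dots> = central_sum p (\<lambda>m. expcoef (\<lambda>w. ?dQ w + - of_int m * of_int (c w)) e)"
    unfolding conv_laur_diff[of c, OF c0]
    by (simp add: conv_laur_exp_sum[of c, OF c(1)] central_sum_def)
  also have "\<dots> = central_sum p (\<lambda>m. expcoef (\<lambda>w. - of_int (m * P w + (p - m) * Q w)) e)"
    by (simp add: c_def algebra_simps)
  finally have 3: "?S ((fls_deriv ?H1 - of_int p * ?H1) * fls_exp (- of_int p)) ?dQ
      - ?S (fls_deriv ?H1) ?dQ - ?S (of_int p * ?H1) ?dQ = \<dots>" .
  have "a + (- b - c) = a - b - c" for a b c :: complex by simp
  then show ?thesis unfolding 1 2 by (simp only: 3)
qed

section \<open>The commutator formula\<close>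

lemma NOpart_eq:
  "NOpart X1 a b e v = (if e X2 = 0 then
     quad (\<lambda>m. expcoef (\<lambda>w. - of_int (m * a w + (- e X1 - m) * b w)) e) (- e X1) v else 0)"
  "NOpart X2 a b e v = (if e X1 = 0 then
     quad (\<lambda>m. expcoef (\<lambda>w. - of_int (m * a w + (- e X2 - m) * b w)) e) (- e X2) v else 0)"
  by (auto simp: NOpart_def quad_def all_var Ys_def Let_def)

lemma Cpart_eq:
  "Cpart a b e v = vscale (if e X1 = 0 \<and> e X2 = 0
     then laur_lin_coef (fls_deriv Hser) (\<lambda>w. a w - b w) e else 0) v"
  by (auto simp: Cpart_def all_var Ys_def)

lemma delta_ser_eq:
  "delta_ser c e v = vscale (if e X2 = - e X1 then expcoef (\<lambda>w. of_int (e X1 * c w)) e else 0) v"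
  by (auto simp: delta_ser_def scalar_ser_def all_var Ys_def)

section \<open>Products with the delta series\<close>

lemma Lbar_scale: "Lbar X2 a b e (vscale c v) = vscale c (Lbar X2 a b e v)"
  by (simp add: Lbar_def ser_scale_def ser_sub_def NOpart_eq Cpart_eq quad_scale
      vscale_diff_right mult.commute)

text \<open>The delta series supplies the whole power of the first x-variable. This fixes its mode
  and leaves mode s for the quadratic operator, while the central part needs s = 0. The
  y-exponentials combine by \<open>conv_expcoef\<close>.\<close>

lemma Lbar_mult_delta:
  fixes e :: "var \<Rightarrow> int"
  assumes ann: "annihilated_above N v" and N: "N \<ge> 0" and Y1: "a Y1 - b Y1 \<noteq> 0"
  defines "s \<equiv> - (e X1 + e X2)"
  shows "ser_mult (Lbar X2 a b) (delta_ser c) e v = vscale (1/2)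
    (quad (\<lambda>m. expcoef (\<lambda>w. of_int (e X1 * c w - (m * a w + (s - m) * b w))) e) s v
     - vscale (if s = 0 then conv 0 (laur_lin_coef (fls_deriv Hser) (\<lambda>w. a w - b w))
         (\<lambda>w. of_int (e X1 * c w)) e else 0) v)"
proof -
  let ?L = "laur_lin_coef (fls_deriv Hser) (\<lambda>w. a w - b w)"
  let ?M = "fls_subdegree (fls_deriv Hser)"
  let ?d = "\<lambda>w. of_int (e X1 * c w) :: complex"
  let ?k = "\<lambda>m w. - of_int (m * a w + (s - m) * b w) :: complex"
  let ?I = "{-(N + \<bar>s\<bar>)..N + \<bar>s\<bar>}"
  define K where "K = \<bar>s\<bar> + \<bar>?M\<bar> + \<bar>e Y1\<bar> + \<bar>e Y2\<bar> + \<bar>e Y3\<bar> + \<bar>e Y4\<bar>"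
  let ?G = "{g :: var \<Rightarrow> int. \<forall>w. g w \<in> {-K..K}}"
  have suppL: "laurent_supp ?M ?L"
    using Y1 by (intro laurent_supp_laur_lin_coef) simp
  \<comment> \<open>\<open>T\<close> and \<open>Z\<close> are the scalar weights of the normal
    ordered and the central part. Both vanish outside the box \<open>?G\<close>, so the sums over g
    and m are finite and can be exchanged.\<close>
  define T where "T g m = (if g X1 = 0 \<and> g X2 = - s
      then expcoef (?k m) g * expcoef ?d (\<lambda>w. e w - g w) else 0)" for g m
  define Z where "Z g = (if g X1 = 0 \<and> g X2 = 0
      then ?L g * expcoef ?d (\<lambda>w. e w - g w) else 0)" for g
  let ?F = "\<lambda>g. Lbar X2 a b g (delta_ser c (\<lambda>w. e w - g w) v)"
  have F: "?F g = vscale (1/2) ((\<Sum>m\<in>?I. vscale (T g m) (normord m (s - m) v))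
      - vscale (if s = 0 then Z g else 0) v)" for g
  proof (cases "g X1 = 0 \<and> g X2 = - s")
    case True
    then have "delta_ser c (\<lambda>w. e w - g w) v = vscale (expcoef ?d (\<lambda>w. e w - g w)) v"
      by (simp add: delta_ser_eq s_def)
    moreover have "Lbar X2 a b g v = vscale (1/2) ((\<Sum>m\<in>?I. vscale (expcoef (?k m) g) (normord m (s - m) v))
        - vscale (if s = 0 then ?L g else 0) v)"
      using True by (simp add: Lbar_def ser_scale_def ser_sub_def NOpart_eq Cpart_eq
          quad_eq_sum[OF ann N order.refl])
    ultimately show ?thesis
      using True by (simp add: Lbar_scale vscale_sum_right vscale_diff_right T_def Z_def mult_ac)
  next
    case False
    have "?F g = 0"
    proof (cases "g X1 = 0")
      case True
      with False have "delta_ser c (\<lambda>w. e w - g w) v = 0"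
        by (auto simp: delta_ser_eq s_def)
      then show ?thesis using Lbar_scale[of a b g 0 0] by simp
    next
      case False
      then show ?thesis by (simp add: Lbar_def ser_scale_def ser_sub_def NOpart_eq Cpart_eq)
    qed
    moreover have "T g m = 0" "(if s = 0 then Z g else 0) = 0" for m
      using False by (auto simp: T_def Z_def)
    ultimately show ?thesis by simp
  qed
  have T0: "T g m = 0" if "g \<notin> ?G" for g m
  proof (rule ccontr)
    assume nz: "T g m \<noteq> 0"
    then have "g X1 = 0" "g X2 = - s" "expcoef (?k m) g \<noteq> 0" "expcoef ?d (\<lambda>w. e w - g w) \<noteq> 0"
      by (auto simp: T_def split: if_splits)
    then have "g \<in> ?G"
      by (intro conv_support_bound[OF laurent_supp_expcoef]) (auto simp: K_def)
    with that show False by simp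
  qed
  have Z0: "Z g = 0" if "g \<notin> ?G" for g
  proof (rule ccontr)
    assume nz: "Z g \<noteq> 0"
    then have "g X1 = 0" "g X2 = 0" "?L g \<noteq> 0" "expcoef ?d (\<lambda>w. e w - g w) \<noteq> 0"
      by (auto simp: Z_def split: if_splits)
    then have "g \<in> ?G"
      by (intro conv_support_bound[OF suppL]) (auto simp: K_def)
    with that show False by simp
  qed
  have "ser_mult (Lbar X2 a b) (delta_ser c) e v = sum ?F ?G"
    unfolding ser_mult_def
  proof (rule Sum_any.expand_superset[OF finite_bounded_exponents], rule subsetI, rule ccontr)
    fix g assume g: "g \<in> {g. ?F g \<noteq> 0}" "g \<notin> ?G"
    from T0[OF g(2)] Z0[OF g(2)] have "?F g = 0" unfolding F by simp
    with g(1) show False by simp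
  qed
  also have "\<dots> = vscale (1/2) ((\<Sum>m\<in>?I. vscale (\<Sum>g\<in>?G. T g m) (normord m (s - m) v))
      - vscale (if s = 0 then (\<Sum>g\<in>?G. Z g) else 0) v)"
  proof -
    have "sum ?F ?G = vscale (1/2) ((\<Sum>g\<in>?G. \<Sum>m\<in>?I. vscale (T g m) (normord m (s - m) v))
        - (\<Sum>g\<in>?G. vscale (if s = 0 then Z g else 0) v))"
      unfolding F by (simp only: vscale_sum_right[symmetric] sum_subtractf)
    then show ?thesis
      by (subst (asm) sum.swap) (auto simp: vscale_sum_left)
  qed
  finally have mult: "ser_mult (Lbar X2 a b) (delta_ser c) e v = \<dots>" .
  have T_sum: "(\<Sum>g\<in>?G. T g m) = expcoef (\<lambda>w. of_int (e X1 * c w - (m * a w + (s - m) * b w))) e" for m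
  proof -
    have "(\<Sum>g\<in>?G. T g m) = conv (- s) (expcoef (?k m)) ?d e"
      unfolding T_def by (rule conv_eq_sum[OF laurent_supp_expcoef, symmetric]) (simp add: K_def)
    then show ?thesis by (simp add: conv_expcoef algebra_simps)
  qed
  have Z_sum: "(\<Sum>g\<in>?G. Z g) = conv 0 ?L ?d e"
    unfolding Z_def by (rule conv_eq_sum[OF suppL, symmetric]) (simp add: K_def)
  show ?thesis by (simp only: mult T_sum Z_sum quad_eq_sum[OF ann N order.refl])
qed

text \<open>Differentiation brings down \<open>\<kappa> m w\<close>, the coefficient of y_w in the
  combined exponent. The central derivative is left unevaluated, because \<open>conv_central\<close>
  evaluates two such terms together.\<close>

lemma Lbar_mult_delta_deriv:
  fixes e c :: "var \<Rightarrow> int"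
  assumes ann: "annihilated_above N v" and N: "N \<ge> 0" and Y1: "a Y1 - b Y1 \<noteq> 0" and w: "w \<in> Ys"
  defines "s \<equiv> - (e X1 + e X2)"
  defines "\<kappa> \<equiv> \<lambda>m w. e X1 * c w - (m * a w + (s - m) * b w)"
  shows "vscale (of_int (e w + 1)) (ser_mult (Lbar X2 a b) (delta_ser c) (e(w := e w + 1)) v) =
    vscale (1/2) (quad (\<lambda>m. of_int (\<kappa> m w) * expcoef (\<lambda>w. of_int (\<kappa> m w)) e) s v
     - vscale (if s = 0 then of_int (e w + 1) * conv 0 (laur_lin_coef (fls_deriv Hser) (\<lambda>w. a w - b w))
         (\<lambda>w. of_int (e X1 * c w)) (e(w := e w + 1)) else 0) v)"
proof -
  let ?e = "e(w := e w + 1)"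
  let ?z = "conv 0 (laur_lin_coef (fls_deriv Hser) (\<lambda>w. a w - b w)) (\<lambda>w. of_int (e X1 * c w)) ?e"
  have eX: "?e X1 = e X1" "?e X2 = e X2"
    using w by (auto simp: Ys_def)
  have k: "of_int (e w + 1) * expcoef (\<lambda>w. of_int (\<kappa> m w)) ?e
      = of_int (\<kappa> m w) * expcoef (\<lambda>w. of_int (\<kappa> m w)) e" for m
    by (rule expcoef_deriv[OF w])
  have "ser_mult (Lbar X2 a b) (delta_ser c) ?e v = vscale (1/2)
    (quad (\<lambda>m. expcoef (\<lambda>w. of_int (\<kappa> m w)) ?e) s v - vscale (if s = 0 then ?z else 0) v)"
    using Lbar_mult_delta[where a = a and b = b and e = ?e and c = c, OF ann N Y1]
    unfolding eX s_def \<kappa>_def .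
  moreover have "vscale r (vscale (1/2) (u - vscale (if s = 0 then ?z else 0) v))
      = vscale (1/2) (vscale r u - vscale (if s = 0 then r * ?z else 0) v)" for r u
    by (simp add: vscale_diff_right mult_ac)
  ultimately show ?thesis
    by (simp only: quad_cmult[OF ann N] k)
qed

text \<open>The two factors involve disjoint sets of variables, so exactly one splitting of the
  exponent vector contributes to each product: \<open>e1\<close> carries x_1, y_1, y_2 and
  \<open>e2\<close> the rest. The commutator becomes that of two single coefficients.\<close>

lemma Lbar_commutator:
  fixes e :: "var \<Rightarrow> int"
  assumes ann: "annihilated_above N v" and N: "N \<ge> 0"
  defines "p \<equiv> - e X1" and "q \<equiv> - e X2"
  defines "E \<equiv> \<lambda>m k. expcoef (\<lambda>w. - of_int (m * yv Y1 w + (p - m) * yv Y2 w + k * yv Y3 w + (q - k) * yv Y4 w)) e"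
  shows "ser_comm (Lbar X1 (yv Y1) (yv Y2)) (Lbar X2 (yv Y3) (yv Y4)) e v = vscale (1/4)
     (quad (\<lambda>m. of_int (p - m) * E m (m - p)) (p + q) v
    + quad (\<lambda>m. of_int (p - m) * E (p - m) (m - p)) (p + q) v
    + quad (\<lambda>m. of_int (p - m) * E m (p + q - m)) (p + q) v
    + quad (\<lambda>m. of_int (p - m) * E (p - m) (p + q - m)) (p + q) v
    + vscale (if p + q = 0 then central_sum p (\<lambda>m. E m (m - p) + E m (- m)) else 0) v)"
proof -
  let ?A = "Lbar X1 (yv Y1) (yv Y2)" and ?B = "Lbar X2 (yv Y3) (yv Y4)"
  define e1 where "e1 = e(X2 := 0, Y3 := 0, Y4 := 0)"
  define e2 where "e2 = e(X1 := 0, Y1 := 0, Y2 := 0)"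
  define C where "C m = expcoef (\<lambda>w. - of_int (m * yv Y1 w + (p - m) * yv Y2 w)) e1" for m
  define D where "D k = expcoef (\<lambda>w. - of_int (k * yv Y3 w + (q - k) * yv Y4 w)) e2" for k
  define \<alpha> where "\<alpha> = (if e X1 = 0 then laur_lin_coef (fls_deriv Hser) (\<lambda>w. yv Y1 w - yv Y2 w) e1 else 0)"
  define \<beta> where "\<beta> = (if e X2 = 0 then laur_lin_coef (fls_deriv Hser) (\<lambda>w. yv Y3 w - yv Y4 w) e2 else 0)"
  have CD: "C m * D k = E m k" for m k
    by (simp add: C_def D_def E_def expcoef_eq yv_def e1_def e2_def)
  have A: "?A e1 u = vscale (1/2) (quad C p u - vscale \<alpha> u)" for u
    by (auto simp: Lbar_def ser_scale_def ser_sub_def NOpart_eq Cpart_eq \<alpha>_def C_def[abs_def] p_def e1_def)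
  have B: "?B e2 u = vscale (1/2) (quad D q u - vscale \<beta> u)" for u
    by (auto simp: Lbar_def ser_scale_def ser_sub_def NOpart_eq Cpart_eq \<beta>_def D_def[abs_def] q_def e2_def)
  have zero: "quad (\<lambda>m. 0) s u = 0" for s u by (simp add: quad_def)
  have A0: "?A g u = 0" if "g X2 \<noteq> 0 \<or> g Y3 \<noteq> 0 \<or> g Y4 \<noteq> 0" for g u
  proof (cases "g X2 = 0")
    case True
    with that obtain w where w: "w \<in> {Y3, Y4}" "g w \<noteq> 0" by auto
    have 1: "expcoef (\<lambda>w. - of_int (m * yv Y1 w + n * yv Y2 w)) g = 0" for m n
      by (rule expcoef_eq_0_coeff[of w]) (use w in \<open>auto simp: Ys_def yv_def\<close>)
    have 2: "laur_lin_coef (fls_deriv Hser) (\<lambda>w. yv Y1 w - yv Y2 w) g = 0"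
      by (rule laur_lin_coef_eq_0_coeff[of w]) (use w in \<open>auto simp: Ys_def yv_def lead_def\<close>)
    show ?thesis
      by (simp add: Lbar_def ser_scale_def ser_sub_def NOpart_eq Cpart_eq 1 2 zero del: of_int_add of_int_mult)
  qed (simp add: Lbar_def ser_scale_def ser_sub_def NOpart_eq Cpart_eq)
  have B0: "?B g u = 0" if "g X1 \<noteq> 0 \<or> g Y1 \<noteq> 0 \<or> g Y2 \<noteq> 0" for g u
  proof (cases "g X1 = 0")
    case True
    with that obtain w where w: "w \<in> {Y1, Y2}" "g w \<noteq> 0" by auto
    have 1: "expcoef (\<lambda>w. - of_int (m * yv Y3 w + n * yv Y4 w)) g = 0" for m n
      by (rule expcoef_eq_0_coeff[of w]) (use w in \<open>auto simp: Ys_def yv_def\<close>)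
    have 2: "laur_lin_coef (fls_deriv Hser) (\<lambda>w. yv Y3 w - yv Y4 w) g = 0"
      by (rule laur_lin_coef_eq_0_coeff[of w]) (use w in \<open>auto simp: Ys_def yv_def lead_def\<close>)
    show ?thesis
      by (simp add: Lbar_def ser_scale_def ser_sub_def NOpart_eq Cpart_eq 1 2 zero del: of_int_add of_int_mult)
  qed (simp add: Lbar_def ser_scale_def ser_sub_def NOpart_eq Cpart_eq)
  have A_zero: "?A g 0 = 0" and B_zero: "?B g 0 = 0" for g
    by (simp_all add: Lbar_def ser_scale_def ser_sub_def NOpart_eq Cpart_eq quad_def)
  have e12: "(\<lambda>w. e w - e1 w) = e2" "(\<lambda>w. e w - e2 w) = e1"
    by (auto simp: var_fun_eq_iff e1_def e2_def)
  have "?A g (?B (\<lambda>w. e w - g w) v) = (if g = e1 then ?A e1 (?B e2 v) else 0)" for g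
  proof (cases "g = e1")
    case False
    then have "(g X2 \<noteq> 0 \<or> g Y3 \<noteq> 0 \<or> g Y4 \<noteq> 0) \<or> (e X1 - g X1 \<noteq> 0 \<or> e Y1 - g Y1 \<noteq> 0 \<or> e Y2 - g Y2 \<noteq> 0)"
      by (auto simp: var_fun_eq_iff e1_def)
    then show ?thesis
      using False A0[of g] B0[of "\<lambda>w. e w - g w" v] A_zero[of g] by auto
  qed (simp add: e12)
  then have AB: "ser_mult ?A ?B e v = ?A e1 (?B e2 v)"
    unfolding ser_mult_def by (simp only: Sum_any.delta)
  have "?B g (?A (\<lambda>w. e w - g w) v) = (if g = e2 then ?B e2 (?A e1 v) else 0)" for g
  proof (cases "g = e2")
    case False
    then have "(g X1 \<noteq> 0 \<or> g Y1 \<noteq> 0 \<or> g Y2 \<noteq> 0) \<or> (e X2 - g X2 \<noteq> 0 \<or> e Y3 - g Y3 \<noteq> 0 \<or> e Y4 - g Y4 \<noteq> 0)"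
      by (auto simp: var_fun_eq_iff e2_def)
    then show ?thesis
      using False B0[of g] A0[of "\<lambda>w. e w - g w" v] B_zero[of g] by auto
  qed (simp add: e12)
  then have BA: "ser_mult ?B ?A e v = ?B e2 (?A e1 v)"
    unfolding ser_mult_def by (simp only: Sum_any.delta)
  show ?thesis
    unfolding ser_comm_def ser_sub_def AB BA A B quad_minus_scalar_commutator[OF ann N]
      quad_commutator[OF ann N] mult.assoc distrib_left CD ..
qed

theorem theorem3p1:
  fixes v :: vec and e :: "var \<Rightarrow> int"
  assumes "fock_vec v"
  shows "ser_comm (Lbar X1 (yv Y1) (yv Y2)) (Lbar X2 (yv Y3) (yv Y4)) e v =
    ser_add
      (ser_scale (-1/2) (ser_deriv Y1 (ser_add
         (ser_mult (Lbar X2 (- yv Y1 + yv Y2 + yv Y3) (yv Y4)) (delta_ser (yv Y1 - yv Y3)))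
         (ser_mult (Lbar X2 (- yv Y1 + yv Y2 + yv Y4) (yv Y3)) (delta_ser (yv Y1 - yv Y4))))))
      (ser_scale (-1/2) (ser_deriv Y2 (ser_add
         (ser_mult (Lbar X2 (yv Y1 - yv Y2 + yv Y3) (yv Y4)) (delta_ser (yv Y2 - yv Y3)))
         (ser_mult (Lbar X2 (yv Y1 - yv Y2 + yv Y4) (yv Y3)) (delta_ser (yv Y2 - yv Y4))))))
      e v"
proof -
  obtain N where N: "N \<ge> 0" and ann: "annihilated_above N v"
    using fock_vec_annihilated_above[OF assms] .
  define p q where "p = - e X1" and "q = - e X2"
  define E where "E = (\<lambda>m k. expcoef
    (\<lambda>w. - of_int (m * yv Y1 w + (p - m) * yv Y2 w + k * yv Y3 w + (q - k) * yv Y4 w)) e)"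
  let ?H = "fls_deriv Hser"
  define z1 where "z1 = of_int (e Y1 + 1) * conv 0
      (laur_lin_coef ?H (\<lambda>w. (- yv Y1 + yv Y2 + yv Y3) w - yv Y4 w))
      (\<lambda>w. of_int (e X1 * (yv Y1 - yv Y3) w)) (e(Y1 := e Y1 + 1))"
  define z2 where "z2 = of_int (e Y1 + 1) * conv 0
      (laur_lin_coef ?H (\<lambda>w. (- yv Y1 + yv Y2 + yv Y4) w - yv Y3 w))
      (\<lambda>w. of_int (e X1 * (yv Y1 - yv Y4) w)) (e(Y1 := e Y1 + 1))"
  define z3 where "z3 = of_int (e Y2 + 1) * conv 0
      (laur_lin_coef ?H (\<lambda>w. (yv Y1 - yv Y2 + yv Y3) w - yv Y4 w))
      (\<lambda>w. of_int (e X1 * (yv Y2 - yv Y3) w)) (e(Y2 := e Y2 + 1))"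
  define z4 where "z4 = of_int (e Y2 + 1) * conv 0
      (laur_lin_coef ?H (\<lambda>w. (yv Y1 - yv Y2 + yv Y4) w - yv Y3 w))
      (\<lambda>w. of_int (e X1 * (yv Y2 - yv Y4) w)) (e(Y2 := e Y2 + 1))"
  \<comment> \<open>Numbered by the four products on the right-hand side. In each, the derivative
    brings down m - p, hence the minus sign that \<open>neg\<close> extracts.\<close>
  let ?Q1 = "quad (\<lambda>m. of_int (p - m) * E (p - m) (m - p)) (p + q) v"
  let ?Q2 = "quad (\<lambda>m. of_int (p - m) * E (p - m) (p + q - m)) (p + q) v"
  let ?Q3 = "quad (\<lambda>m. of_int (p - m) * E m (m - p)) (p + q) v"
  let ?Q4 = "quad (\<lambda>m. of_int (p - m) * E m (p + q - m)) (p + q) v"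
  have s: "- (e X1 + e X2) = p + q" by (simp add: p_def q_def)
  have neg: "quad F (p + q) v = vscale (-1) (quad G (p + q) v)" if "\<And>m. F m = - G m" for F G
  proof -
    have "F = (\<lambda>m. -1 * G m)" using that by auto
    then show ?thesis by (simp only: quad_cmult[OF ann N])
  qed
  have T: "vscale (of_int (e w + 1)) (ser_mult (Lbar X2 a b) (delta_ser c) (e(w := e w + 1)) v)
    = vscale (1/2) (vscale (-1) (quad G (p + q) v) - vscale (if p + q = 0
        then of_int (e w + 1) * conv 0 (laur_lin_coef ?H (\<lambda>w. a w - b w))
          (\<lambda>w. of_int (e X1 * c w)) (e(w := e w + 1)) else 0) v)"
    if "a Y1 - b Y1 \<noteq> 0" "w \<in> Ys"
      "\<And>m. of_int (e X1 * c w - (m * a w + (p + q - m) * b w))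
        * expcoef (\<lambda>w. of_int (e X1 * c w - (m * a w + (p + q - m) * b w))) e = - G m"
    for a b c w G
    unfolding Lbar_mult_delta_deriv[where a = a and b = b, OF ann N that(1,2)] s
    by (subst neg[OF that(3)]) (rule refl)
  have T1: "vscale (of_int (e Y1 + 1)) (ser_mult (Lbar X2 (- yv Y1 + yv Y2 + yv Y3) (yv Y4))
      (delta_ser (yv Y1 - yv Y3)) (e(Y1 := e Y1 + 1)) v)
    = vscale (1/2) (vscale (-1) ?Q1 - vscale (if p + q = 0 then z1 else 0) v)"
    unfolding z1_def
    by (rule T) (simp_all add: E_def expcoef_eq Ys_def yv_def p_def algebra_simps)
  have T2: "vscale (of_int (e Y1 + 1)) (ser_mult (Lbar X2 (- yv Y1 + yv Y2 + yv Y4) (yv Y3))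
      (delta_ser (yv Y1 - yv Y4)) (e(Y1 := e Y1 + 1)) v)
    = vscale (1/2) (vscale (-1) ?Q2 - vscale (if p + q = 0 then z2 else 0) v)"
    unfolding z2_def
    by (rule T) (simp_all add: E_def expcoef_eq Ys_def yv_def p_def algebra_simps)
  have T3: "vscale (of_int (e Y2 + 1)) (ser_mult (Lbar X2 (yv Y1 - yv Y2 + yv Y3) (yv Y4))
      (delta_ser (yv Y2 - yv Y3)) (e(Y2 := e Y2 + 1)) v)
    = vscale (1/2) (vscale (-1) ?Q3 - vscale (if p + q = 0 then z3 else 0) v)"
    unfolding z3_def
    by (rule T) (simp_all add: E_def expcoef_eq Ys_def yv_def p_def algebra_simps)
  have T4: "vscale (of_int (e Y2 + 1)) (ser_mult (Lbar X2 (yv Y1 - yv Y2 + yv Y4) (yv Y3))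
      (delta_ser (yv Y2 - yv Y4)) (e(Y2 := e Y2 + 1)) v)
    = vscale (1/2) (vscale (-1) ?Q4 - vscale (if p + q = 0 then z4 else 0) v)"
    unfolding z4_def
    by (rule T) (simp_all add: E_def expcoef_eq Ys_def yv_def p_def algebra_simps)
  have even: "laur_lin_coef ?H (\<lambda>w. - c w) = laur_lin_coef ?H c" if "c Y1 \<noteq> 0" for c
    using laur_lin_coef_even[of c ?H, OF that deriv_Hser_nth_odd] by blast
  have z14: "z1 + z4 = central_sum p (\<lambda>m. E m (- m))" if "p + q = 0"
  proof -
    \<comment> \<open>P and Q are the forms in the delta series of the first and the fourth product.
      Their central parts have arguments Q - P and P - Q, which evenness of H' identifies.\<close>
    define P Q :: "var \<Rightarrow> int" where "P = yv Y1 - yv Y3" and "Q = yv Y2 - yv Y4"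
    have "laur_lin_coef ?H (\<lambda>w. (- yv Y1 + yv Y2 + yv Y3) w - yv Y4 w) = laur_lin_coef ?H (\<lambda>w. P w - Q w)"
      using even[of "\<lambda>w. P w - Q w"] by (simp add: P_def Q_def yv_def algebra_simps)
    moreover have "(\<lambda>w. (yv Y1 - yv Y2 + yv Y4) w - yv Y3 w) = (\<lambda>w. P w - Q w)"
      by (auto simp: P_def Q_def)
    ultimately have "z1 + z4 = central_sum p (\<lambda>m. expcoef (\<lambda>w. - of_int (m * P w + (p - m) * Q w)) e)"
      unfolding z1_def z4_def P_def[symmetric] Q_def[symmetric]
      using conv_central[of P Q e 0 p] by (simp add: P_def Q_def yv_def p_def)
    also have "\<dots> = central_sum p (\<lambda>m. E m (- m))"
    proof -
      have "q = - p" using that by simp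
      then have "expcoef (\<lambda>w. - of_int (m * P w + (p - m) * Q w)) e = E m (- m)" for m
        by (simp add: E_def P_def Q_def expcoef_eq yv_def algebra_simps)
      then show ?thesis by simp
    qed
    finally show ?thesis .
  qed
  have z23: "z2 + z3 = central_sum p (\<lambda>m. E m (m - p))" if "p + q = 0"
  proof -
    \<comment> \<open>The same pairing for the second and third product, with y_3 and y_4
      exchanged.\<close>
    define P Q :: "var \<Rightarrow> int" where "P = yv Y1 - yv Y4" and "Q = yv Y2 - yv Y3"
    have "laur_lin_coef ?H (\<lambda>w. (- yv Y1 + yv Y2 + yv Y4) w - yv Y3 w) = laur_lin_coef ?H (\<lambda>w. P w - Q w)"
      using even[of "\<lambda>w. P w - Q w"] by (simp add: P_def Q_def yv_def algebra_simps)
    moreover have "(\<lambda>w. (yv Y1 - yv Y2 + yv Y3) w - yv Y4 w) = (\<lambda>w. P w - Q w)"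
      by (auto simp: P_def Q_def)
    ultimately have "z2 + z3 = central_sum p (\<lambda>m. expcoef (\<lambda>w. - of_int (m * P w + (p - m) * Q w)) e)"
      unfolding z2_def z3_def P_def[symmetric] Q_def[symmetric]
      using conv_central[of P Q e 0 p] by (simp add: P_def Q_def yv_def p_def)
    also have "\<dots> = central_sum p (\<lambda>m. E m (m - p))"
    proof -
      have "q = - p" using that by simp
      then have "expcoef (\<lambda>w. - of_int (m * P w + (p - m) * Q w)) e = E m (m - p)" for m
        by (simp add: E_def P_def Q_def expcoef_eq yv_def algebra_simps)
      then show ?thesis by simp
    qed
    finally show ?thesis .
  qed
  have z: "(if p + q = 0 then central_sum p (\<lambda>m. E m (m - p) + E m (- m)) else 0) =
      (if p + q = 0 then z1 else 0) + (if p + q = 0 then z2 else 0)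
    + (if p + q = 0 then z3 else 0) + (if p + q = 0 then z4 else 0)"
  proof (cases "p + q = 0")
    case True
    then show ?thesis
      using z14[OF True, symmetric] z23[OF True, symmetric] by (simp add: central_sum_add[symmetric])
  qed simp
  have comm: "ser_comm (Lbar X1 (yv Y1) (yv Y2)) (Lbar X2 (yv Y3) (yv Y4)) e v =
      vscale (1/4) (?Q3 + ?Q1 + ?Q4 + ?Q2 + vscale (if p + q = 0
        then central_sum p (\<lambda>m. E m (m - p) + E m (- m)) else 0) v)"
    unfolding E_def p_def q_def by (rule Lbar_commutator[OF ann N])
  have "vscale (1/4) (A3 + A1 + A4 + A2 + vscale (a1 + a2 + a3 + a4) v) =
      vscale (-1/2) (vscale (1/2) (vscale (-1) A1 - vscale a1 v) + vscale (1/2) (vscale (-1) A2 - vscale a2 v))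
    + vscale (-1/2) (vscale (1/2) (vscale (-1) A3 - vscale a3 v) + vscale (1/2) (vscale (-1) A4 - vscale a4 v))"
    for A1 A2 A3 A4 a1 a2 a3 a4
    by (simp add: vscale_def fun_eq_iff algebra_simps)
  then show ?thesis
    unfolding comm z ser_add_def ser_scale_def ser_deriv_def vscale_add_right[of "of_int _"] T1 T2 T3 T4 .
qed

end
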